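(* Let $\mathcal{O}\subset\mathbb{R}^3$ be the open ball of radius $\rho\ge1$ centered at the origin, $M=\mathbb{R}^3\setminus\mathcal{O}$, and $\lambda>0$. For $\mu=(j,\ell,m)$ with $j\in\{1,2\}$, $\ell\ge1$, $|m|\le\ell$, let $Y_\mu=\Psi_{j,\ell,m}$. The Maxwell generalized eigenfunction for the perfectly conducting sphere of radius $\rho$ (the field on $M$ of the form $\tilde j_\lambda(Y_\mu)+\tilde h^{(1)}_\lambda(A_\lambda Y_\mu)$ satisfying $\nu\times E=0$ on $\partial\mathcal{O}$) is given by $$E^{\mathrm{curl}}_\lambda(Y_\mu)|_{\mathbb{R}^3\setminus\mathcal{O}}=\tilde j_\lambda(Y_\mu)+\tilde h^{(1)}_\lambda(A^t_\lambda Y_\mu),$$ where $A^t_\lambda$ is the diagonal matrix, with respect to the basis $\{\Psi_{j,\ell,m}\}_{j=1,2}$ of $L^2_t(\mathbb{S}^2,\mathbb{C}^3)$, with entries $$\langle A^t_\lambda\Psi_{1,\ell,m},\Psi_{1,\ell,m}\rangle=-\frac{2j_\ell(\lambda\rho)}{h^{(1)}_\ell(\lambda\rho)},\qquad \langle A^t_\lambda\Psi_{2,\ell,m},\Psi_{2,\ell,m}\rangle=-\frac{2(zj_\ell(z))'|_{z=\lambda\rho}}{(zh^{(1)}_\ell(z))'|_{z=\lambda\rho}}.$$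
   Context: $\nu$ is the outward unit normal on $\partial\mathcal{O}$; $'$ denotes $d/dz$. Write $x=r\hat r$, $r=|x|$. Let $Y_{\ell m}$ ($\ell\ge1$, $|m|\le\ell$) be the standard real $L^2(\mathbb{S}^2)$-orthonormal scalar spherical harmonics, viewed as functions of $\hat r$. Vector spherical harmonics: $$\Psi_{1,\ell,m}=\tfrac{1}{\sqrt{\ell(\ell+1)}}\nabla Y_{\ell m}\times x,\quad \Psi_{2,\ell,m}=\tfrac{r}{\sqrt{\ell(\ell+1)}}\nabla Y_{\ell m},\quad \Psi_{3,\ell,m}=\hat r\,Y_{\ell m}.$$ They depend only on $\hat r$. $L^2_t(\mathbb{S}^2,\mathbb{C}^3)$ is the subspace of $L^2(\mathbb{S}^2,\mathbb{C}^3)$ of tangential fields; $\{\Psi_{j,\ell,m}\}_{j=1,2}$ is an orthonormal basis of it. Let $j_\ell$ and $h^{(1)}_\ell$ be the spherical Bessel function and the spherical Hankel function of the first kind. For $Y\in L^2_t(\mathbb{S}^2,\mathbb{C}^3)$ with $a_{j,\ell,m}=\langle Y,\Psi_{j,\ell,m}\rangle$ put $$\tilde j_\lambda(Y)=2\sum_{\ell,m}\Big[a_{1,\ell,m}(-\mathrm{i})^\ell\lambda j_\ell(\lambda r)\Psi_{1,\ell,m}+a_{2,\ell,m}(-\mathrm{i})^{\ell-1}\Big(\tfrac{(zj_\ell(z))'|_{z=\lambda r}}{r}\Psi_{2,\ell,m}+\tfrac{\sqrt{\ell(\ell+1)}\,j_\ell(\lambda r)}{r}\Psi_{3,\ell,m}\Big)\Big],$$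 $$\tilde h^{(1)}_\lambda(Y)=\sum_{\ell,m}\Big[a_{1,\ell,m}(-\mathrm{i})^\ell\lambda h^{(1)}_\ell(\lambda r)\Psi_{1,\ell,m}+a_{2,\ell,m}(-\mathrm{i})^{\ell-1}\Big(\tfrac{(zh^{(1)}_\ell(z))'|_{z=\lambda r}}{r}\Psi_{2,\ell,m}+\tfrac{\sqrt{\ell(\ell+1)}\,h^{(1)}_\ell(\lambda r)}{r}\Psi_{3,\ell,m}\Big)\Big],$$ whenever these sums converge in $C^\infty(M,\mathbb{C}^3)$. For $Y\in L^2_t(\mathbb{S}^2,\mathbb{C}^3)$, $E^{\mathrm{curl}}_\lambda(Y)=\tilde j_\lambda(Y)+\tilde h^{(1)}_\lambda(A_\lambda Y)$ on $M$, where the linear map $A_\lambda$ on tangential fields is the one determined by the requirement $\nu\times E^{\mathrm{curl}}_\lambda(Y)=0$ on $\partial\mathcal{O}$. *)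

theory Defs
  imports "HOL-Analysis.Analysis" "HOL-Computational_Algebra.Polynomial"
begin

type_synonym field3 = "real^3 \<Rightarrow> complex^3"

section \<open>Spherical Bessel and Hankel functions\<close>

(* Rayleigh's formulas:
     j_l(z) =  (-z)^l ((1/z) d/dz)^l (sin z / z),
     y_l(z) = -(-z)^l ((1/z) d/dz)^l (cos z / z),   h^(1)_l = j_l + i y_l.
   They are used only at real z > 0, so the values at z = 0 play no role. *)

definition sph_bessel_j :: "nat \<Rightarrow> complex \<Rightarrow> complex" where
  "sph_bessel_j l z = (-z) ^ l * (((\<lambda>f w. deriv f w / w) ^^ l) (\<lambda>w. sin w / w)) z"

definition sph_bessel_y :: "nat \<Rightarrow> complex \<Rightarrow> complex" where
  "sph_bessel_y l z = - ((-z) ^ l) * (((\<lambda>f w. deriv f w / w) ^^ l) (\<lambda>w. cos w / w)) z"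

definition sph_hankel :: "nat \<Rightarrow> complex \<Rightarrow> complex" where
  "sph_hankel l z = sph_bessel_j l z + \<i> * sph_bessel_y l z"

(* riccati f l z = (z f_l(z))', a derivative in z that is evaluated at z afterwards. *)
definition riccati :: "(nat \<Rightarrow> complex \<Rightarrow> complex) \<Rightarrow> nat \<Rightarrow> complex \<Rightarrow> complex" where
  "riccati f l z = deriv (\<lambda>w. w * f l w) z"


section \<open>Partial derivatives and complex vector fields\<close>

definition partial :: "3 \<Rightarrow> (real^3 \<Rightarrow> 'a::real_normed_vector) \<Rightarrow> real^3 \<Rightarrow> 'a" where
  "partial i f x = vector_derivative (\<lambda>t. f (x + t *\<^sub>R axis i 1)) (at 0)"

definition partials :: "3 list \<Rightarrow> (real^3 \<Rightarrow> 'a::real_normed_vector) \<Rightarrow> real^3 \<Rightarrow> 'a" where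
  "partials is f = foldr partial is f"

definition grad :: "(real^3 \<Rightarrow> real) \<Rightarrow> real^3 \<Rightarrow> real^3" where
  "grad f x = (\<chi> i. partial i f x)"

definition cvec :: "real^3 \<Rightarrow> complex^3" where
  "cvec v = (\<chi> i. complex_of_real (v $ i))"

(* Cross product of a real with a complex vector, complex-linear in the second argument. *)
definition ccross :: "real^3 \<Rightarrow> complex^3 \<Rightarrow> complex^3" where
  "ccross v w = cvec (cross3 v (\<chi> i. Re (w $ i))) + \<i> *s cvec (cross3 v (\<chi> i. Im (w $ i)))"


section \<open>Scalar and vector spherical harmonics\<close>

(* Rodrigues' formula. *)
definition legendre_poly :: "nat \<Rightarrow> real poly" where
  "legendre_poly l = smult (1 / (2 ^ l * fact l)) ((pderiv ^^ l) ([:-1, 0, 1:] ^ l))"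

(* The standard real harmonics in polar angle theta and azimuth phi, with k = |m|:
     N (sin theta)^k (d/dt)^k P_l(t) at t = cos theta,
   times sqrt 2 cos (k phi), 1, sqrt 2 sin (k phi) for m > 0, m = 0, m < 0.  As a function of
   x / |x| it is written with cos theta = x3 / r and
   (sin theta)^k e^(i k phi) = ((x1 + i x2) / r)^k. *)
definition sph_harm :: "nat \<Rightarrow> int \<Rightarrow> real^3 \<Rightarrow> real" where
  "sph_harm l m x =
     (let k = nat \<bar>m\<bar>; r = norm x; w = Complex (x $ 1 / r) (x $ 2 / r) ^ k in
      sqrt ((2 * real l + 1) / (4 * pi) * (fact (l - k) / fact (l + k)))
      * poly ((pderiv ^^ k) (legendre_poly l)) (x $ 3 / r)
      * (if m = 0 then 1 else if m > 0 then sqrt 2 * Re w else sqrt 2 * Im w))"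

definition vsh_real :: "nat \<Rightarrow> nat \<Rightarrow> int \<Rightarrow> real^3 \<Rightarrow> real^3" where
  "vsh_real j l m x =
     (if j = 1 then (1 / sqrt (real l * (real l + 1))) *\<^sub>R cross3 (grad (sph_harm l m) x) x
      else if j = 2 then (norm x / sqrt (real l * (real l + 1))) *\<^sub>R grad (sph_harm l m) x
      else sph_harm l m x *\<^sub>R (x /\<^sub>R norm x))"

definition Psi :: "nat \<Rightarrow> nat \<Rightarrow> int \<Rightarrow> field3" where
  "Psi j l m x = cvec (vsh_real j l m x)"

definition harm_index :: "(nat \<times> int) set" where
  "harm_index = {(l, m). 1 \<le> l \<and> \<bar>m\<bar> \<le> int l}"


section \<open>Tangential square-integrable fields on the unit sphere\<close>

(* Surface measure: sin theta dtheta dphi in spherical coordinates. *)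
definition sphere_point :: "real \<times> real \<Rightarrow> real^3" where
  "sphere_point = (\<lambda>(t, p). vector [sin t * cos p, sin t * sin p, cos t])"

definition sphere_measure :: "(real^3) measure" where
  "sphere_measure =
     distr (density lborel (\<lambda>(t, p). ennreal (indicator ({0..pi} \<times> {0..2 * pi}) (t, p) * sin t)))
           (restrict_space borel (sphere 0 1)) sphere_point"

(* Elements of L^2 are represented by functions, up to equality almost everywhere. *)
definition L2t :: "field3 set" where
  "L2t = {Y. Y \<in> borel_measurable sphere_measure
           \<and> integrable sphere_measure (\<lambda>x. (norm (Y x))\<^sup>2)
           \<and> (AE x in sphere_measure. (\<Sum>i\<in>UNIV. complex_of_real (x $ i) * Y x $ i) = 0)}"

definition L2_inner :: "field3 \<Rightarrow> field3 \<Rightarrow> complex" where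
  "L2_inner Y Z = (\<integral>x. (\<Sum>i\<in>UNIV. Y x $ i * cnj (Z x $ i)) \<partial>sphere_measure)"

(* A linear map of the space of classes: it respects equality almost everywhere (take b = 0). *)
definition L2t_linear :: "(field3 \<Rightarrow> field3) \<Rightarrow> bool" where
  "L2t_linear A \<longleftrightarrow>
     (\<forall>Y\<in>L2t. A Y \<in> L2t) \<and>
     (\<forall>Y\<in>L2t. \<forall>Y1\<in>L2t. \<forall>Y2\<in>L2t. \<forall>a b.
        (AE x in sphere_measure. Y x = a *s Y1 x + b *s Y2 x) \<longrightarrow>
        (AE x in sphere_measure. A Y x = a *s A Y1 x + b *s A Y2 x))"


section \<open>The multipole series\<close>

(* The exterior of the ball, including the boundary. *)
definition exterior :: "real \<Rightarrow> (real^3) set" where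
  "exterior rho = - ball 0 rho"

definition multipole :: "(nat \<Rightarrow> complex \<Rightarrow> complex) \<Rightarrow> real \<Rightarrow> field3 \<Rightarrow> nat \<times> int \<Rightarrow> field3" where
  "multipole f lam Y = (\<lambda>(l, m) x.
     let r = norm x; z = complex_of_real (lam * r) in
       (L2_inner Y (Psi 1 l m) * (-\<i>) ^ l * complex_of_real lam * f l z) *s Psi 1 l m x
     + (L2_inner Y (Psi 2 l m) * (-\<i>) ^ (l - 1)) *s
         ((riccati f l z / complex_of_real r) *s Psi 2 l m x
          + (complex_of_real (sqrt (real l * (real l + 1))) * f l z / complex_of_real r)
              *s Psi 3 l m x))"

(* Unordered convergence of a series in C^infinity(M): all partial derivatives of the finite
   partial sums converge uniformly on compact subsets of M.  As M may contain boundary points, the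
   terms have to be smooth on a neighbourhood of M.  The sum is then the pointwise one. *)
definition Cinf_summable :: "(real^3) set \<Rightarrow> ('i \<Rightarrow> field3) \<Rightarrow> 'i set \<Rightarrow> bool" where
  "Cinf_summable M f I \<longleftrightarrow>
     (\<forall>is K. compact K \<and> K \<subseteq> M \<longrightarrow>
        (\<exists>g. uniform_limit K (\<lambda>F. partials is (\<lambda>x. \<Sum>i\<in>F. f i x)) g (finite_subsets_at_top I)))"

definition tilde_j :: "real \<Rightarrow> field3 \<Rightarrow> field3" where
  "tilde_j lam Y x = 2 *s (\<Sum>\<^sub>\<infinity>i\<in>harm_index. multipole sph_bessel_j lam Y i x)"

definition tilde_h :: "real \<Rightarrow> field3 \<Rightarrow> field3" where
  "tilde_h lam Y x = (\<Sum>\<^sub>\<infinity>i\<in>harm_index. multipole sph_hankel lam Y i x)"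


section \<open>Generalized eigenfunctions of the perfectly conducting sphere\<close>

(* Z is an admissible value of A_lam at Y: both series converge and the field
   tilde_j(Y) + tilde_h(Z) satisfies nu x E = 0 on the boundary, with nu = x / rho. *)
definition boundary_solution :: "real \<Rightarrow> real \<Rightarrow> field3 \<Rightarrow> field3 \<Rightarrow> bool" where
  "boundary_solution lam rho Y Z \<longleftrightarrow>
     Z \<in> L2t
     \<and> Cinf_summable (exterior rho) (multipole sph_bessel_j lam Y) harm_index
     \<and> Cinf_summable (exterior rho) (multipole sph_hankel lam Z) harm_index
     \<and> (\<forall>x\<in>sphere 0 rho. ccross (x /\<^sub>R rho) (tilde_j lam Y x + tilde_h lam Z x) = 0)"

(* The requirement is imposed at every Y for which it can be met at all, so that existence of
   the map does not depend on convergence of the series for arbitrary Y. *)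
definition is_scattering_map :: "real \<Rightarrow> real \<Rightarrow> (field3 \<Rightarrow> field3) \<Rightarrow> bool" where
  "is_scattering_map lam rho A \<longleftrightarrow>
     L2t_linear A
     \<and> (\<forall>Y\<in>L2t. (\<exists>Z. boundary_solution lam rho Y Z) \<longrightarrow> boundary_solution lam rho Y (A Y))"

(* A choice among representatives that have the same coefficients. *)
definition A_op :: "real \<Rightarrow> real \<Rightarrow> field3 \<Rightarrow> field3" where
  "A_op lam rho = (SOME A. is_scattering_map lam rho A)"

definition E_curl :: "real \<Rightarrow> real \<Rightarrow> field3 \<Rightarrow> field3" where
  "E_curl lam rho Y x = tilde_j lam Y x + tilde_h lam (A_op lam rho Y) x"

definition At_entry :: "real \<Rightarrow> real \<Rightarrow> nat \<Rightarrow> nat \<Rightarrow> complex" where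
  "At_entry lam rho j l =
     (let z = complex_of_real (lam * rho) in
      if j = 1 then - (2 * sph_bessel_j l z / sph_hankel l z)
      else - (2 * riccati sph_bessel_j l z / riccati sph_hankel l z))"

(* The operator that is diagonal in the basis Psi_{j,l,m}, j = 1, 2: it multiplies each
   coefficient by the corresponding entry.  The choice is of a representative of the L^2 class. *)
definition At_op :: "real \<Rightarrow> real \<Rightarrow> field3 \<Rightarrow> field3" where
  "At_op lam rho Y = (SOME Z. Z \<in> L2t \<and>
     (\<forall>j\<in>{1, 2}. \<forall>(l, m)\<in>harm_index.
        L2_inner Z (Psi j l m) = At_entry lam rho j l * L2_inner Y (Psi j l m)))"

end

(* The Riccati-Bessel functions of the first and second kind are real on the real axis and have
   Wronskian 1, so neither h_l nor (z h_l)' vanishes at a real point, and the entries of A^t are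
   well defined.

   On the sphere of radius rho every term of tilde_j(Y) + tilde_h(Z) is a combination of
   Psi_1, Psi_2 and the normal field Psi_3.  Integrating the uniformly convergent series against a
   tangential Psi_{j,l,m} shows that the boundary condition forces the coefficient of Psi_{j,l,m} to
   vanish, which is exactly <Z, Psi_{j,l,m}> = A^t_{j,l} <Y, Psi_{j,l,m}>.  This needs only
   orthonormality of the vector harmonics, not completeness.  In spherical coordinates orthogonality
   in m is that of the trigonometric system; the Legendre equation and an integration by parts turn
   the integral of grad Y . grad Y' into l(l+1) times that of Y Y', which by symmetry gives
   orthogonality in l, and the norms follow by descent from k = l, where P_l^(l) is constant.

   A linear choice of A_lambda on all of L^2_t exists by pure linear algebra: the admissible pairs
   (Y, Z) form a subspace, and a Hamel basis that extends a basis of the null functions gives a linear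
   selection that vanishes on null functions. *)

theory Submission
  imports Defs "HOL-Complex_Analysis.Cauchy_Integral_Formula" "HOL-Library.Function_Algebras"
begin

section \<open>Spherical Bessel functions\<close>

text \<open>Existence of a boundary solution is therefore shown only for a series with one nonzero
  term, whose partial sums are eventually constant, and uniqueness uses only the empty list of
  derivatives on the compact sphere of radius rho. For the same reason the linear selection is made
  for the coefficient relation <Z, Psi> = At <Y, Psi>: it contains every boundary solution and is
  closed under sums and multiples at once, whereas closure of \<open>boundary_solution\<close> would
  involve smoothness of the multipoles.

  \<open>A_op\<close> and \<open>At_op\<close> are choices and may have different values. They enter
  \<open>multipole\<close> only through inner products with Psi_1 and Psi_2, so equal coefficients
  give equal series at every point, not merely almost everywhere.

  In spherical coordinates the azimuthal component of a gradient carries 1 / sin theta. The surface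
  weight sin theta or the quotient \<open>polar_quot\<close> absorbs it, so that only functions
  continuous up to the poles are integrated.\<close>

definition rayleigh :: "(complex \<Rightarrow> complex) \<Rightarrow> nat \<Rightarrow> complex \<Rightarrow> complex" where
  "rayleigh s l = ((\<lambda>f w. deriv f w / w) ^^ l) (\<lambda>w. s w / w)"

lemma sph_bessel_j_eq: "sph_bessel_j l z = (-z) ^ l * rayleigh sin l z"
  by (simp add: sph_bessel_j_def rayleigh_def)

lemma sph_bessel_y_eq: "sph_bessel_y l z = - ((-z) ^ l * rayleigh cos l z)"
  by (simp add: sph_bessel_y_def rayleigh_def)

lemma rayleigh_0: "rayleigh s 0 z = s z / z"
  by (simp add: rayleigh_def)

lemma rayleigh_Suc: "rayleigh s (Suc l) z = deriv (rayleigh s l) z / z"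
  by (simp add: rayleigh_def)

lemma rayleigh_holomorphic:
  assumes "s holomorphic_on UNIV"
  shows "rayleigh s l holomorphic_on -{0}"
proof (induction l)
  case 0
  have "(\<lambda>z. s z / z) holomorphic_on -{0}"
    using assms by (intro holomorphic_intros) (auto intro: holomorphic_on_subset)
  then show ?case by (simp add: rayleigh_def)
next
  case (Suc l)
  have "(\<lambda>z. deriv (rayleigh s l) z / z) holomorphic_on -{0}"
    using Suc by (intro holomorphic_intros holomorphic_deriv) auto
  then show ?case by (simp add: rayleigh_Suc[abs_def])
qed

text \<open>Splitting off (-z)^l leaves functions for which differentiation is multiplication by z
  together with a shift of l. Recurrence, Wronskian and reality follow from this rule without the
  Bessel equation.\<close>

lemma rayleigh_has_field_derivative:
  assumes "s holomorphic_on UNIV" "z \<noteq> 0"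
  shows "(rayleigh s l has_field_derivative z * rayleigh s (Suc l) z) (at z)"
proof -
  have "open (- {0::complex})" by auto
  from holomorphic_derivI[OF rayleigh_holomorphic[OF assms(1)] this, of z l UNIV]
  show ?thesis using assms(2) by (simp add: rayleigh_Suc)
qed

lemma rayleigh_1:
  assumes s: "\<And>z. (s has_field_derivative s' z) (at z)" and z: "z \<noteq> 0"
  shows "rayleigh s 1 z = s' z / z\<^sup>2 - s z / z ^ 3"
proof -
  have "((\<lambda>z. s z / z) has_field_derivative (s' z * z - s z) / (z * z)) (at z)"
    using z by (auto intro!: derivative_eq_intros s)
  then have "deriv (rayleigh s 0) z = (s' z * z - s z) / (z * z)"
    by (simp add: rayleigh_def DERIV_imp_deriv)
  then show ?thesis
    using z by (simp add: rayleigh_Suc field_simps power2_eq_square power3_eq_cube)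
qed

text \<open>For l = 0 this is s'' = -s; differentiating the relation for l and dividing by z gives
  the one for l + 1. Multiplied by (-z)^l it is the classical f_(l+2) + f_l = (2l + 3) f_(l+1) /
  z.\<close>

lemma rayleigh_recurrence:
  assumes s: "\<And>z. (s has_field_derivative s' z) (at z)"
    and s': "\<And>z. (s' has_field_derivative - s z) (at z)"
    and z: "z \<noteq> 0"
  shows "z\<^sup>2 * rayleigh s (Suc (Suc l)) z + (2 * of_nat l + 3) * rayleigh s (Suc l) z
           + rayleigh s l z = 0"
  using z
proof (induction l arbitrary: z)
  case 0
  have hol: "s holomorphic_on UNIV"
    using s by (auto simp: holomorphic_on_def field_differentiable_def)
  have "((\<lambda>w. s' w / w\<^sup>2 - s w / w ^ 3) has_field_derivative
      (- s z / z\<^sup>2 - 2 * s' z / z ^ 3) - (s' z / z ^ 3 - 3 * s z / z ^ 4)) (at z)"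
    using 0 by (auto intro!: derivative_eq_intros s s' simp: field_simps power2_eq_square power3_eq_cube power4_eq_xxxx)
  then have "(rayleigh s 1 has_field_derivative
      (- s z / z\<^sup>2 - 2 * s' z / z ^ 3) - (s' z / z ^ 3 - 3 * s z / z ^ 4)) (at z)"
    using 0 rayleigh_1[OF s]
    by (subst DERIV_cong_ev[OF refl _ refl, of _ "\<lambda>w. s' w / w\<^sup>2 - s w / w ^ 3"])
      (auto intro!: eventually_mono[OF eventually_nhds_in_open[of "-{0}"]])
  then have "z * rayleigh s (Suc 1) z =
      (- s z / z\<^sup>2 - 2 * s' z / z ^ 3) - (s' z / z ^ 3 - 3 * s z / z ^ 4)"
    using rayleigh_has_field_derivative[OF hol 0] DERIV_unique by blast
  then have *: "rayleigh s (Suc (Suc 0)) z =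
      ((- s z / z\<^sup>2 - 2 * s' z / z ^ 3) - (s' z / z ^ 3 - 3 * s z / z ^ 4)) / z"
    using 0 by (simp add: field_simps)
  have **: "rayleigh s (Suc 0) z = s' z / z\<^sup>2 - s z / z ^ 3"
    using rayleigh_1[OF s 0] by simp
  show ?case
    using 0 unfolding * ** rayleigh_0
    by (simp add: field_simps power2_eq_square power3_eq_cube power4_eq_xxxx)
next
  case (Suc l)
  have hol: "s holomorphic_on UNIV"
    using s by (auto simp: holomorphic_on_def field_differentiable_def)
  note D = rayleigh_has_field_derivative[OF hol Suc.prems]
  let ?h = "\<lambda>z. z\<^sup>2 * rayleigh s (Suc (Suc l)) z + (2 * of_nat l + 3) * rayleigh s (Suc l) z
           + rayleigh s l z"
  have "(?h has_field_derivative (2 * z * rayleigh s (Suc (Suc l)) z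
      + z\<^sup>2 * (z * rayleigh s (Suc (Suc (Suc l))) z)
      + (2 * of_nat l + 3) * (z * rayleigh s (Suc (Suc l)) z) + z * rayleigh s (Suc l) z)) (at z)"
    by (auto intro!: derivative_eq_intros D)
  \<comment> \<open>The induction hypothesis makes \<open>?h\<close> vanish at all nonzero points,
    hence near z; this is why z is generalised in the induction.\<close>
  moreover have "(?h has_field_derivative 0) (at z)"
    using Suc.prems Suc.IH
    by (subst DERIV_cong_ev[OF refl _ refl, of _ "\<lambda>w. 0"])
      (auto intro!: eventually_mono[OF eventually_nhds_in_open[of "-{0}"]])
  ultimately have "2 * z * rayleigh s (Suc (Suc l)) z
      + z\<^sup>2 * (z * rayleigh s (Suc (Suc (Suc l))) z)
      + (2 * of_nat l + 3) * (z * rayleigh s (Suc (Suc l)) z) + z * rayleigh s (Suc l) z = 0"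
    using DERIV_unique by blast
  then have "z * (z\<^sup>2 * rayleigh s (Suc (Suc (Suc l))) z
      + (2 * of_nat (Suc l) + 3) * rayleigh s (Suc (Suc l)) z + rayleigh s (Suc l) z) = 0"
    by (simp add: algebra_simps)
  then show ?case using Suc.prems by simp
qed

lemmas rayleigh_sin_recurrence = rayleigh_recurrence[of sin cos, OF DERIV_sin DERIV_cos]
lemma rayleigh_cos_recurrence:
  "z \<noteq> 0 \<Longrightarrow> z\<^sup>2 * rayleigh cos (Suc (Suc l)) z + (2 * of_nat l + 3) * rayleigh cos (Suc l) z
     + rayleigh cos l z = 0"
  by (rule rayleigh_recurrence[of cos "\<lambda>z. - sin z"]) (auto intro!: derivative_eq_intros)

text \<open>Equivalent to j_l y_(l+1) - j_(l+1) y_l = -1 / z^2. By the recurrence the determinant is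
  divided by z^2 when l grows by one, and the case l = 0 is sin^2 + cos^2 = 1.\<close>

lemma rayleigh_wronskian:
  assumes z: "z \<noteq> 0"
  shows "z ^ (2 * l + 3) *
      (rayleigh sin l z * rayleigh cos (Suc l) z - rayleigh sin (Suc l) z * rayleigh cos l z) = -1"
proof (induction l)
  case 0
  have c: "rayleigh cos (Suc 0) z = - sin z / z\<^sup>2 - cos z / z ^ 3"
    using rayleigh_1[of cos "\<lambda>z. - sin z" z] z by (auto intro!: derivative_eq_intros)
  have s: "rayleigh sin (Suc 0) z = cos z / z\<^sup>2 - sin z / z ^ 3"
    using rayleigh_1[of sin cos z] z by (auto intro!: derivative_eq_intros)
  have "z ^ 3 * (a / z * (- a / z\<^sup>2 - b / z ^ 3) - (b / z\<^sup>2 - a / z ^ 3) * (b / z)) = - (a\<^sup>2 + b\<^sup>2)" for a b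
    using z by (simp add: field_simps power2_eq_square power3_eq_cube)
  then have "z ^ 3 * (rayleigh sin 0 z * rayleigh cos (Suc 0) z - rayleigh sin (Suc 0) z * rayleigh cos 0 z)
      = - ((sin z)\<^sup>2 + (cos z)\<^sup>2)"
    unfolding c s rayleigh_0 by this
  then show ?case by simp
next
  case (Suc l)
  let ?g = "\<lambda>l. rayleigh sin l z" and ?q = "\<lambda>l. rayleigh cos l z"
  have "z\<^sup>2 * (?g (Suc l) * ?q (Suc (Suc l)) - ?g (Suc (Suc l)) * ?q (Suc l))
      = ?g l * ?q (Suc l) - ?g (Suc l) * ?q l"
    using rayleigh_sin_recurrence[OF z, of l] rayleigh_cos_recurrence[OF z, of l]
    by algebra
  moreover have "z ^ (2 * Suc l + 3) = z ^ (2 * l + 3) * z\<^sup>2"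
    by (simp flip: power_add)
  ultimately show ?case using Suc by (metis mult.assoc)
qed

text \<open>Being real on the real axis is a condition on a line and does not pass through a complex
  \<open>deriv\<close>. The reflection symmetry holds on an open set, and conjugating both argument
  and value conjugates the derivative, so it survives the induction.\<close>

lemma rayleigh_cnj:
  assumes hol: "s holomorphic_on UNIV" and real: "\<And>z. s (cnj z) = cnj (s z)"
    and "z \<noteq> 0"
  shows "rayleigh s l (cnj z) = cnj (rayleigh s l z)"
  using \<open>z \<noteq> 0\<close>
proof (induction l arbitrary: z)
  case 0
  then show ?case by (simp add: rayleigh_0 real)
next
  case (Suc l)
  have "(rayleigh s l has_field_derivative cnj z * rayleigh s (Suc l) (cnj z)) (at (cnj z))"
    using rayleigh_has_field_derivative[OF hol, of "cnj z" l] Suc.prems by simp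
  then have "((cnj \<circ> rayleigh s l \<circ> cnj) has_field_derivative cnj (cnj z * rayleigh s (Suc l) (cnj z))) (at z)"
    using has_field_derivative_cnj_cnj[of "rayleigh s l" _ z] by fast
  moreover have ev: "\<forall>\<^sub>F w in nhds z. rayleigh s l w = (cnj \<circ> rayleigh s l \<circ> cnj) w"
    using eventually_nhds_in_open[of "-{0}" z] Suc.prems
    by (auto elim!: eventually_mono simp: Suc.IH open_Compl)
  ultimately have "(rayleigh s l has_field_derivative cnj (cnj z * rayleigh s (Suc l) (cnj z))) (at z)"
    using DERIV_cong_ev[OF refl ev refl] by blast
  then have "z * rayleigh s (Suc l) z = cnj (cnj z * rayleigh s (Suc l) (cnj z))"
    using rayleigh_has_field_derivative[OF hol Suc.prems] DERIV_unique by blast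
  then have "rayleigh s (Suc l) z = cnj (rayleigh s (Suc l) (cnj z))"
    using Suc.prems by simp
  then show ?case by (metis complex_cnj_cnj)
qed

lemma rayleigh_real:
  assumes "s \<in> {sin, cos}" "x \<noteq> 0"
  shows "rayleigh s l (complex_of_real x) \<in> \<real>"
proof -
  have "rayleigh s l (cnj (of_real x)) = cnj (rayleigh s l (of_real x))"
    using assms by (intro rayleigh_cnj) (auto intro: holomorphic_intros simp: cnj_sin cnj_cos)
  then show ?thesis by (simp add: Reals_cnj_iff)
qed

text \<open>The extra factor is taken into the power, w (-w)^l = - (-w)^(l+1). The outcome combines
  two consecutive Rayleigh functions, the shape to which the Wronskian applies.\<close>

lemma riccati_rayleigh:
  assumes hol: "s holomorphic_on UNIV" and z: "z \<noteq> 0"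
  shows "((\<lambda>w. w * ((-w) ^ l * rayleigh s l w)) has_field_derivative
           (-z) ^ l * ((of_nat l + 1) * rayleigh s l z + z\<^sup>2 * rayleigh s (Suc l) z)) (at z)"
proof -
  have m: "((\<lambda>w. (-w) ^ Suc l) has_field_derivative - (of_nat (Suc l) * (-z) ^ l)) (at z)"
    by (auto intro!: derivative_eq_intros simp del: power_Suc)
  have "((\<lambda>w. - ((-w) ^ Suc l * rayleigh s l w)) has_field_derivative
      - (- (of_nat (Suc l) * (-z) ^ l) * rayleigh s l z + z * rayleigh s (Suc l) z * (-z) ^ Suc l)) (at z)"
    by (rule DERIV_minus[OF DERIV_mult[OF m rayleigh_has_field_derivative[OF hol z]]])
  moreover have "(\<lambda>w. - ((-w) ^ Suc l * rayleigh s l w)) = (\<lambda>w. w * ((-w) ^ l * rayleigh s l w))"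
    by (simp add: fun_eq_iff)
  moreover have "- (- (of_nat (Suc l) * (-z) ^ l) * rayleigh s l z + z * rayleigh s (Suc l) z * (-z) ^ Suc l)
     = (-z) ^ l * ((of_nat l + 1) * rayleigh s l z + z\<^sup>2 * rayleigh s (Suc l) z)"
    by (simp add: algebra_simps power2_eq_square)
  ultimately show ?thesis
    by simp
qed

section \<open>Absence of real zeros of h_l and (z h_l)'\<close>

lemma sin_cos_entire:
  "sin holomorphic_on (UNIV :: complex set)" "cos holomorphic_on (UNIV :: complex set)"
  by (auto simp: holomorphic_on_def field_differentiable_def intro: DERIV_sin DERIV_cos)

lemma riccati_hankel:
  assumes z: "z \<noteq> 0"
  shows "riccati sph_hankel l z
    = (-z) ^ l * ((of_nat l + 1) * rayleigh sin l z + z\<^sup>2 * rayleigh sin (Suc l) z)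
      - \<i> * ((-z) ^ l * ((of_nat l + 1) * rayleigh cos l z + z\<^sup>2 * rayleigh cos (Suc l) z))"
proof -
  have "(\<lambda>w. w * sph_hankel l w)
      = (\<lambda>w. w * ((-w) ^ l * rayleigh sin l w) - \<i> * (w * ((-w) ^ l * rayleigh cos l w)))"
    by (simp add: sph_hankel_def sph_bessel_j_eq sph_bessel_y_eq algebra_simps)
  then show ?thesis
    unfolding riccati_def
    using DERIV_imp_deriv[OF DERIV_diff[OF riccati_rayleigh[OF sin_cos_entire(1) z, of l]
          DERIV_cmult[OF riccati_rayleigh[OF sin_cos_entire(2) z, of l], of \<i>]]]
    by (simp only:)
qed

lemma Reals_diff_i_mult_eq_0:
  assumes "a - \<i> * b = 0" "a \<in> \<real>" "b \<in> \<real>"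
  shows "a = 0 \<and> b = 0"
  using assms by (auto simp: complex_eq_iff complex_is_Real_iff)

lemma sph_hankel_nonzero:
  assumes "x \<noteq> 0"
  shows "sph_hankel l (complex_of_real x) \<noteq> 0"
proof
  let ?z = "complex_of_real x"
  assume "sph_hankel l ?z = 0"
  then have "(-?z) ^ l * (rayleigh sin l ?z - \<i> * rayleigh cos l ?z) = 0"
    by (simp add: sph_hankel_def sph_bessel_j_eq sph_bessel_y_eq algebra_simps)
  then have "rayleigh sin l ?z - \<i> * rayleigh cos l ?z = 0"
    using assms by simp
  then have "rayleigh sin l ?z = 0 \<and> rayleigh cos l ?z = 0"
    using assms by (intro Reals_diff_i_mult_eq_0 rayleigh_real) auto
  then show False
    using rayleigh_wronskian[of ?z l] assms by simp
qed

lemma riccati_hankel_nonzero: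
  assumes "x \<noteq> 0"
  shows "riccati sph_hankel l (complex_of_real x) \<noteq> 0"
proof
  let ?z = "complex_of_real x"
  let ?u = "\<lambda>s. (of_nat l + 1) * rayleigh s l ?z + ?z\<^sup>2 * rayleigh s (Suc l) ?z"
  assume "riccati sph_hankel l ?z = 0"
  then have "(-?z) ^ l * (?u sin - \<i> * ?u cos) = 0"
    using riccati_hankel[of ?z l] assms by (simp add: algebra_simps)
  then have "?u sin - \<i> * ?u cos = 0"
    using assms by simp
  then have "?u sin = 0 \<and> ?u cos = 0"
    using assms by (intro Reals_diff_i_mult_eq_0 Reals_add Reals_mult Reals_power rayleigh_real) auto
  \<comment> \<open>Cross-multiplying the two relations \<open>?u sin = 0\<close> and
    \<open>?u cos = 0\<close> by \<open>rayleigh cos l\<close> and \<open>rayleigh sin l\<close>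
    cancels the l + 1 terms and leaves z^2 times the Wronskian.\<close>
  then have "?z\<^sup>2 * (rayleigh sin l ?z * rayleigh cos (Suc l) ?z - rayleigh sin (Suc l) ?z * rayleigh cos l ?z) = 0"
    by algebra
  then have "rayleigh sin l ?z * rayleigh cos (Suc l) ?z - rayleigh sin (Suc l) ?z * rayleigh cos l ?z = 0"
    using assms by simp
  then show False
    using rayleigh_wronskian[of ?z l] assms by simp
qed

section \<open>Gradients of spherical harmonics\<close>

text \<open>Links the coordinatewise \<open>grad\<close> to the Frechet derivative; pairing with an
  arbitrary v lets v be a frame vector or the position x later on.\<close>

lemma grad_inner:
  assumes "(f has_derivative D) (at x)"
  shows "grad f x \<bullet> v = D v"
proof -
  interpret bounded_linear D using assms by (rule has_derivative_bounded_linear)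
  have *: "partial i f x = D (axis i 1)" for i
  proof -
    have "((\<lambda>t. f (x + t *\<^sub>R axis i 1)) has_derivative (\<lambda>t. D (t *\<^sub>R axis i 1))) (at 0)"
      by (rule has_derivative_compose[of "\<lambda>t. x + t *\<^sub>R axis i 1" "\<lambda>t. t *\<^sub>R axis i 1", simplified])
        (auto intro!: derivative_eq_intros assms)
    then show ?thesis
      unfolding partial_def by (intro vector_derivative_at) (simp add: has_vector_derivative_def scaleR)
  qed
  have "D v = D (\<Sum>i\<in>UNIV. v $ i *\<^sub>R axis i 1)"
    using basis_expansion[of v] by (simp add: scalar_mult_eq_scaleR)
  then show ?thesis
    by (simp add: sum scaleR grad_def inner_vec_def * mult.commute)
qed

text \<open>For m = 0 the value is Re w and not the constant 1 of \<open>sph_harm\<close>: this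
  keeps the map real-linear, and in a harmonic it meets the zeroth power w^0 = 1.\<close>

definition azimuthal :: "int \<Rightarrow> complex \<Rightarrow> real" where
  "azimuthal m w = (if m = 0 then Re w else if m > 0 then sqrt 2 * Re w else sqrt 2 * Im w)"

lemma bounded_linear_azimuthal: "bounded_linear (azimuthal m)"
  unfolding azimuthal_def
  by (cases "m = 0"; cases "m > 0")
    (auto intro!: bounded_linear_Re bounded_linear_Im bounded_linear_const_mult)

definition legendre_deriv :: "nat \<Rightarrow> nat \<Rightarrow> real poly" where
  "legendre_deriv l k = (pderiv ^^ k) (legendre_poly l)"

lemma pderiv_legendre_deriv: "pderiv (legendre_deriv l k) = legendre_deriv l (Suc k)"
  by (simp add: legendre_deriv_def)

definition harm_const :: "nat \<Rightarrow> nat \<Rightarrow> real" where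
  "harm_const l k = sqrt ((2 * real l + 1) / (4 * pi) * (fact (l - k) / fact (l + k)))"

definition plane :: "real ^ 3 \<Rightarrow> complex" where
  "plane y = Complex (y $ 1) (y $ 2)"

lemma bounded_linear_plane: "bounded_linear plane"
proof -
  have "plane = (\<lambda>y. of_real (y $ 1) + \<i> * of_real (y $ 2))"
    by (simp add: plane_def fun_eq_iff complex_eq_iff)
  moreover have "bounded_linear (\<lambda>y::real^3. complex_of_real (y $ 1) + \<i> * complex_of_real (y $ 2))"
    by (intro bounded_linear_add bounded_linear_const_mult
        bounded_linear_compose[OF bounded_linear_of_real] bounded_linear_vec_nth)
  ultimately show ?thesis by simp
qed

(* A polynomial whose values at x / |x| are those of the spherical harmonic. *)
definition harm_ext :: "nat \<Rightarrow> int \<Rightarrow> real ^ 3 \<Rightarrow> real" where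
  "harm_ext l m y = harm_const l (nat \<bar>m\<bar>) * (poly (legendre_deriv l (nat \<bar>m\<bar>)) (y $ 3)
     * azimuthal m (plane y ^ nat \<bar>m\<bar>))"

text \<open>The truncated exponent k - 1 is harmless at k = 0 because of the factor
  \<open>of_nat k\<close>.\<close>

definition harm_ext_deriv :: "nat \<Rightarrow> int \<Rightarrow> real ^ 3 \<Rightarrow> real ^ 3 \<Rightarrow> real" where
  "harm_ext_deriv l m y v = (let k = nat \<bar>m\<bar> in harm_const l k *
     (poly (legendre_deriv l k) (y $ 3) * azimuthal m (of_nat k * plane v * plane y ^ (k - 1))
      + poly (legendre_deriv l (Suc k)) (y $ 3) * v $ 3 * azimuthal m (plane y ^ k)))"

lemma sph_harm_eq_harm_ext: "sph_harm l m x = harm_ext l m (x /\<^sub>R norm x)"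
proof -
  have "Complex (x $ 1 / norm x) (x $ 2 / norm x) = plane (x /\<^sub>R norm x)"
    by (simp add: plane_def field_simps)
  then show ?thesis
    by (auto simp: sph_harm_def harm_ext_def Let_def azimuthal_def harm_const_def
        legendre_deriv_def field_simps)
qed

lemma has_derivative_harm_ext: "(harm_ext l m has_derivative harm_ext_deriv l m y) (at y)"
proof -
  let ?k = "nat \<bar>m\<bar>"
  have 1: "((\<lambda>y::real^3. poly (legendre_deriv l ?k) (y $ 3)) has_derivative
      (\<lambda>v. v $ 3 * poly (legendre_deriv l (Suc ?k)) (y $ 3))) (at y)"
    using has_derivative_compose[OF bounded_linear_imp_has_derivative[OF bounded_linear_vec_nth]
        poly_DERIV[unfolded has_field_derivative_def], where p1 = "legendre_deriv l ?k"]
    by (simp add: pderiv_legendre_deriv mult.commute)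
  have 2: "((\<lambda>y. azimuthal m (plane y ^ ?k)) has_derivative
      (\<lambda>v. azimuthal m (of_nat ?k * plane v * plane y ^ (?k - 1)))) (at y)"
    by (intro bounded_linear.has_derivative[OF bounded_linear_azimuthal] has_derivative_power
        bounded_linear.has_derivative[OF bounded_linear_plane] has_derivative_ident)
  show ?thesis
    unfolding harm_ext_def harm_ext_deriv_def Let_def
    by (rule has_derivative_eq_rhs, rule has_derivative_mult_right, rule has_derivative_mult[OF 1 2])
      (simp add: fun_eq_iff algebra_simps)
qed

lemma has_derivative_normalize:
  fixes x :: "'a :: real_inner"
  assumes "x \<noteq> 0"
  shows "((\<lambda>x. x /\<^sub>R norm x) has_derivative
      (\<lambda>v. v /\<^sub>R norm x - ((x \<bullet> v) / norm x ^ 3) *\<^sub>R x)) (at x)"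
  by (rule has_derivative_eq_rhs, rule has_derivative_scaleR,
      rule Deriv.has_derivative_inverse[OF _ has_derivative_norm[OF assms]], use assms in simp,
      rule has_derivative_ident)
    (use assms in \<open>simp add: fun_eq_iff sgn_div_norm divide_inverse power3_eq_cube inner_commute mult_ac\<close>)

lemma has_derivative_sph_harm:
  assumes "x \<noteq> 0"
  shows "(sph_harm l m has_derivative
      (\<lambda>v. harm_ext_deriv l m (x /\<^sub>R norm x) (v /\<^sub>R norm x - ((x \<bullet> v) / norm x ^ 3) *\<^sub>R x))) (at x)"
  using has_derivative_compose[OF has_derivative_normalize[OF assms] has_derivative_harm_ext[of l m]]
  by (simp add: sph_harm_eq_harm_ext[abs_def])

lemma grad_sph_harm_inner:
  assumes "x \<noteq> 0"
  shows "grad (sph_harm l m) x \<bullet> v =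
    harm_ext_deriv l m (x /\<^sub>R norm x) (v /\<^sub>R norm x - ((x \<bullet> v) / norm x ^ 3) *\<^sub>R x)"
  by (rule grad_inner[OF has_derivative_sph_harm[OF assms]])

lemma linear_harm_ext_deriv: "linear (harm_ext_deriv l m y)"
  using has_derivative_harm_ext has_derivative_linear by blast

section \<open>Tangency, homogeneity and continuity of the vector harmonics\<close>

lemma grad_sph_harm_radial: "grad (sph_harm l m) x \<bullet> x = 0" if "x \<noteq> 0"
proof -
  have "x /\<^sub>R norm x - ((x \<bullet> x) / norm x ^ 3) *\<^sub>R x = 0"
    using that by (simp add: dot_square_norm power2_eq_square power3_eq_cube inverse_eq_divide)
  then show ?thesis
    using that by (simp add: grad_sph_harm_inner linear_0[OF linear_harm_ext_deriv])
qed

text \<open>The harmonic is homogeneous of degree 0, so its gradient has degree -1. The factor x or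
  |x| in \<open>vsh_real\<close> compensates, and the vector harmonics depend on the direction
  only.\<close>

lemma grad_sph_harm_scale:
  assumes "c > 0" "x \<noteq> 0"
  shows "grad (sph_harm l m) (c *\<^sub>R x) = grad (sph_harm l m) x /\<^sub>R c"
proof -
  have "grad (sph_harm l m) (c *\<^sub>R x) \<bullet> v = (grad (sph_harm l m) x /\<^sub>R c) \<bullet> v" for v
  proof -
    have "v /\<^sub>R norm (c *\<^sub>R x) - ((c *\<^sub>R x \<bullet> v) / norm (c *\<^sub>R x) ^ 3) *\<^sub>R (c *\<^sub>R x)
      = (1 / c) *\<^sub>R (v /\<^sub>R norm x - ((x \<bullet> v) / norm x ^ 3) *\<^sub>R x)"
      using assms by (simp add: scaleR_diff_right power3_eq_cube field_simps)
    moreover have "(c *\<^sub>R x) /\<^sub>R norm (c *\<^sub>R x) = x /\<^sub>R norm x"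
      using assms by (simp add: field_simps)
    ultimately show ?thesis
      using assms linear_cmul[OF linear_harm_ext_deriv]
      by (simp add: grad_sph_harm_inner inverse_eq_divide)
  qed
  then show ?thesis using vector_eq_rdot by blast
qed

lemma sph_harm_scale: "c > 0 \<Longrightarrow> sph_harm l m (c *\<^sub>R x) = sph_harm l m x"
  by (simp add: sph_harm_eq_harm_ext field_simps)

lemma vsh_real_scale:
  assumes "c > 0" "x \<noteq> 0"
  shows "vsh_real j l m (c *\<^sub>R x) = vsh_real j l m x"
  using assms
  by (simp add: vsh_real_def grad_sph_harm_scale sph_harm_scale cross_mult_left cross_mult_right field_simps)

lemma Psi_scale: "c > 0 \<Longrightarrow> x \<noteq> 0 \<Longrightarrow> Psi j l m (c *\<^sub>R x) = Psi j l m x"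
  by (simp add: Psi_def vsh_real_scale)

lemma vsh_real_tangential:
  assumes "j \<in> {1, 2}" "x \<noteq> 0"
  shows "x \<bullet> vsh_real j l m x = 0"
proof -
  have "x \<bullet> grad (sph_harm l m) x = 0"
    using grad_sph_harm_radial[OF assms(2)] by (subst inner_commute)
  then show ?thesis
    using assms(1) by (auto simp: vsh_real_def dot_cross_self)
qed

lemma continuous_on_grad_sph_harm: "continuous_on (sphere 0 1) (grad (sph_harm l m))"
proof -
  \<comment> \<open>On the unit sphere the normalising denominators are 1, and the projected
    derivative is a polynomial expression in x.\<close>
  have "grad (sph_harm l m) x $ i = harm_ext_deriv l m x (axis i 1 - x $ i *\<^sub>R x)"
    if "x \<in> sphere 0 1" for x i
  proof -
    from that have "norm x = 1" "x \<noteq> 0" by auto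
    then show ?thesis
      using grad_sph_harm_inner[of x l m "axis i 1"] by (simp add: inner_axis)
  qed
  moreover have "continuous_on (sphere 0 1) (\<lambda>x. harm_ext_deriv l m x (axis i 1 - x $ i *\<^sub>R x))" for i
    unfolding harm_ext_deriv_def Let_def
    by (intro continuous_intros bounded_linear.continuous_on[OF bounded_linear_azimuthal]
        bounded_linear.continuous_on[OF bounded_linear_plane] continuous_on_poly)
  ultimately have "continuous_on (sphere 0 1) (\<lambda>x. grad (sph_harm l m) x $ i)" for i
    by (metis (no_types, lifting) continuous_on_cong)
  then have "continuous_on (sphere 0 1) (\<lambda>x. \<chi> i. grad (sph_harm l m) x $ i)"
    by (rule continuous_on_vec_lambda)
  then show ?thesis by simp
qed

lemma continuous_on_sph_harm: "continuous_on (sphere 0 1) (sph_harm l m)"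
proof -
  have "isCont (sph_harm l m) x" if "x \<in> sphere 0 1" for x
    using that by (intro has_derivative_continuous[OF has_derivative_sph_harm]) auto
  then show ?thesis by (simp add: continuous_at_imp_continuous_on)
qed

lemma continuous_on_vsh_real: "continuous_on (sphere 0 1) (vsh_real j l m)"
proof -
  have "continuous_on (sphere 0 1) (\<lambda>x. a *\<^sub>R cross3 (grad (sph_harm l m) x) x)"
    "continuous_on (sphere 0 1) (\<lambda>x. (norm x * a) *\<^sub>R grad (sph_harm l m) x)"
    "continuous_on (sphere 0 1) (\<lambda>x::real^3. sph_harm l m x *\<^sub>R (x /\<^sub>R norm x))" for a
    by (auto intro!: continuous_intros continuous_on_cross continuous_on_grad_sph_harm continuous_on_sph_harm)
  then show ?thesis
    by (cases "j = 1"; cases "j = 2") (auto simp: vsh_real_def[abs_def] divide_inverse)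
qed

lemma continuous_on_cvec:
  assumes "continuous_on S f"
  shows "continuous_on S (\<lambda>x. cvec (f x))"
  unfolding cvec_def using assms
  by (intro continuous_on_vec_lambda continuous_on_of_real continuous_on_component) auto

lemma continuous_on_Psi: "continuous_on (sphere 0 1) (Psi j l m)"
  unfolding Psi_def by (intro continuous_on_cvec continuous_on_vsh_real)

section \<open>Legendre functions\<close>

text \<open>With u = (t^2 - 1)^l the source is (t^2 - 1) u' = 2 l t u. One differentiation gives n =
  0, and each further one raises n, which replaces Leibniz' rule.\<close>

lemma poly_pderiv_iterate_ode:
  fixes l n :: nat
  defines "w \<equiv> \<lambda>n. poly ((pderiv ^^ n) ([:-1, 0, 1:] ^ l :: real poly))"
  shows "(t\<^sup>2 - 1) * w (n + 2) t + 2 * (real n + 1 - real l) * t * w (n + 1) t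
    + (real n + 1) * (real n - 2 * real l) * w n t = 0"
proof -
  have D: "(w k has_real_derivative w (Suc k) t) (at t)" for k t
    unfolding w_def by (auto intro!: derivative_eq_intros)
  have w1: "(t\<^sup>2 - 1) * w 1 t - 2 * real l * t * w 0 t = 0" for t
  proof (cases l)
    case (Suc k)
    have "w 1 t = real (Suc k) * (t\<^sup>2 - 1) ^ k * (2 * t)"
      unfolding w_def Suc by (simp only: One_nat_def funpow.simps comp_apply id_apply pderiv_power_Suc)
        (simp add: pderiv_pCons power2_eq_square algebra_simps)
    moreover have "w 0 t = (t\<^sup>2 - 1) ^ Suc k"
      unfolding w_def Suc by (simp only: funpow.simps id_apply poly_power) (simp add: power2_eq_square algebra_simps)
    ultimately show ?thesis using Suc by simp
  qed (simp add: w_def)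
  show ?thesis
  proof (induction n arbitrary: t)
    case 0
    have "((\<lambda>t. (t\<^sup>2 - 1) * w 1 t - 2 * real l * t * w 0 t) has_real_derivative
        (t\<^sup>2 - 1) * w 2 t + 2 * t * w 1 t - (2 * real l * w 0 t + 2 * real l * t * w 1 t)) (at t)"
      by (auto intro!: derivative_eq_intros D simp: numeral_2_eq_2)
    moreover have "((\<lambda>t. (t\<^sup>2 - 1) * w 1 t - 2 * real l * t * w 0 t) has_real_derivative 0) (at t)"
      unfolding w1 by simp
    ultimately have "(t\<^sup>2 - 1) * w 2 t + 2 * t * w 1 t - (2 * real l * w 0 t + 2 * real l * t * w 1 t) = 0"
      by (rule DERIV_unique)
    then show ?case by (simp add: algebra_simps numeral_2_eq_2)
  next
    case (Suc n)
    let ?f = "\<lambda>t. (t\<^sup>2 - 1) * w (n + 2) t + 2 * (real n + 1 - real l) * t * w (n + 1) t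
      + (real n + 1) * (real n - 2 * real l) * w n t"
    have "(?f has_real_derivative (t\<^sup>2 - 1) * w (Suc n + 2) t + 2 * t * w (n + 2) t
        + (2 * (real n + 1 - real l) * t * w (n + 2) t + 2 * (real n + 1 - real l) * w (n + 1) t)
        + (real n + 1) * (real n - 2 * real l) * w (n + 1) t) (at t)"
      by (auto intro!: derivative_eq_intros D)
    moreover have "(?f has_real_derivative 0) (at t)"
      unfolding Suc by simp
    ultimately have "(t\<^sup>2 - 1) * w (Suc n + 2) t + 2 * t * w (n + 2) t
        + (2 * (real n + 1 - real l) * t * w (n + 2) t + 2 * (real n + 1 - real l) * w (n + 1) t)
        + (real n + 1) * (real n - 2 * real l) * w (n + 1) t = 0"
      by (rule DERIV_unique)
    then show ?case by (simp add: algebra_simps)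
  qed
qed

lemma legendre_deriv_eq:
  "legendre_deriv l k = smult (1 / (2 ^ l * fact l)) ((pderiv ^^ (l + k)) ([:-1, 0, 1:] ^ l))"
  unfolding legendre_deriv_def legendre_poly_def higher_pderiv_smult
  by (simp add: funpow_add add.commute[of l k])

text \<open>The preceding equation at n = l + k, where n + 1 - l = k + 1 and (n + 1)(n - 2l) = - (l
  - k)(l + k + 1). For k = 0 it is Legendre's equation.\<close>

lemma legendre_deriv_ode:
  shows "(1 - t\<^sup>2) * poly (legendre_deriv l (Suc (Suc k))) t
    - 2 * (real k + 1) * t * poly (legendre_deriv l (Suc k)) t
    + (real l - real k) * (real l + real k + 1) * poly (legendre_deriv l k) t = 0"
proof -
  define w where "w k = poly ((pderiv ^^ (l + k)) ([:-1, 0, 1:] ^ l :: real poly)) t" for k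
  define C :: real where "C = 1 / (2 ^ l * fact l)"
  have e: "poly (legendre_deriv l k) t = C * w k" for k
    by (simp add: legendre_deriv_eq C_def w_def)
  have "(t\<^sup>2 - 1) * w (Suc (Suc k)) + 2 * (real (l + k) + 1 - real l) * t * w (Suc k)
    + (real (l + k) + 1) * (real (l + k) - 2 * real l) * w k = 0"
    using poly_pderiv_iterate_ode[of t "l + k" l] by (simp add: w_def)
  then have "C * ((t\<^sup>2 - 1) * w (Suc (Suc k)) + 2 * (real k + 1) * t * w (Suc k)
    + (real l + real k + 1) * (real k - real l) * w k) = 0"
    by simp
  then show ?thesis
    unfolding e by (simp add: algebra_simps)
qed

text \<open>Here 2l derivatives fall on the monic polynomial (t^2 - 1)^l of degree 2l and leave
  (2l)!.\<close>

lemma legendre_deriv_top: "poly (legendre_deriv l l) t = fact (2 * l) / (2 ^ l * fact l)"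
proof -
  let ?u = "[:-1, 0, 1:] ^ l :: real poly"
  have deg: "degree ?u = 2 * l"
    by (simp add: degree_power_eq)
  have lc: "coeff ?u (2 * l) = 1"
    using lead_coeff_power[of "[:-1, 0, 1:] :: real poly" l] deg by simp
  have "(pderiv ^^ (2 * l)) ?u = [:fact (2 * l):]"
  proof (rule poly_eqI)
    fix n
    show "coeff ((pderiv ^^ (2 * l)) ?u) n = coeff [:fact (2 * l):] n"
      using deg lc
      by (cases n) (auto simp: coeff_higher_pderiv coeff_eq_0 pochhammer_fact)
  qed
  then show ?thesis
    unfolding legendre_deriv_eq mult_2[symmetric] by simp
qed

text \<open>The associated Legendre function at cos t without the Condon-Shortley sign.\<close>

definition polar :: "nat \<Rightarrow> nat \<Rightarrow> real \<Rightarrow> real" where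
  "polar l k t = sin t ^ k * poly (legendre_deriv l k) (cos t)"

definition polar_deriv :: "nat \<Rightarrow> nat \<Rightarrow> real \<Rightarrow> real" where
  "polar_deriv l k t = real k * sin t ^ (k - 1) * cos t * poly (legendre_deriv l k) (cos t)
     - sin t ^ (k + 1) * poly (legendre_deriv l (Suc k)) (cos t)"

(* k * polar l k t / sin t, in a form that makes sense at the poles *)
definition polar_quot :: "nat \<Rightarrow> nat \<Rightarrow> real \<Rightarrow> real" where
  "polar_quot l k t = real k * sin t ^ (k - 1) * poly (legendre_deriv l k) (cos t)"

lemma has_field_derivative_legendre_cos:
  "((\<lambda>t. poly (legendre_deriv l k) (cos t)) has_field_derivative
     - sin t * poly (legendre_deriv l (Suc k)) (cos t)) (at t within S)"
  by (rule derivative_eq_intros DERIV_chain2[OF poly_DERIV] refl)+ (simp add: pderiv_legendre_deriv)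

lemma has_field_derivative_sin_power:
  "((\<lambda>t::real. sin t ^ n) has_field_derivative real n * sin t ^ (n - 1) * cos t) (at t within S)"
  by (auto intro!: derivative_eq_intros)

lemma has_field_derivative_polar:
  "(polar l k has_field_derivative polar_deriv l k t) (at t within S)"
  unfolding polar_def polar_deriv_def
  by (rule DERIV_cong[OF DERIV_mult[OF has_field_derivative_sin_power has_field_derivative_legendre_cos]])
    (simp add: algebra_simps)

lemma sin_mult_polar_quot: "sin t * polar_quot l k t = real k * polar l k t"
  by (cases k) (auto simp: polar_quot_def polar_def)

text \<open>The associated Legendre equation in the angle, (sin u')' = k^2 u / sin - l (l + 1) sin
  u, with k u / sin written as \<open>polar_quot\<close>.\<close>

lemma has_field_derivative_sin_polar_deriv:
  "((\<lambda>t. sin t * polar_deriv l k t) has_field_derivative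
      real k * polar_quot l k t - real l * (real l + 1) * (sin t * polar l k t)) (at t within S)"
proof -
  let ?P = "\<lambda>k. poly (legendre_deriv l k) (cos t)"
  \<comment> \<open>The factor sin t removes the truncated exponent k - 1: it becomes k for k > 0,
    and for k = 0 the term is zero anyway.\<close>
  have eq: "(\<lambda>t. sin t * polar_deriv l k t) = (\<lambda>t. real k * (sin t ^ k * cos t * poly (legendre_deriv l k) (cos t))
     - sin t ^ (k + 2) * poly (legendre_deriv l (Suc k)) (cos t))"
    by (cases k) (auto simp: polar_deriv_def fun_eq_iff algebra_simps)
  have "((\<lambda>t. sin t * polar_deriv l k t) has_field_derivative
      real k * (real k * sin t ^ (k - 1) * cos t * cos t * ?P k - sin t ^ k * sin t * ?P k
        - sin t ^ k * cos t * sin t * ?P (Suc k))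
      - (real (k + 2) * sin t ^ (k + 1) * cos t * ?P (Suc k) - sin t ^ (k + 2) * sin t * ?P (Suc (Suc k))))
      (at t within S)"
    unfolding eq
    by (rule DERIV_cong[OF DERIV_diff[OF
            DERIV_cmult[OF DERIV_mult[OF DERIV_mult[OF has_field_derivative_sin_power
              has_field_derivative_at_within[OF DERIV_cos]] has_field_derivative_legendre_cos]]
            DERIV_mult[OF has_field_derivative_sin_power has_field_derivative_legendre_cos]]])
      (simp add: algebra_simps)
  also have "real k * (real k * sin t ^ (k - 1) * cos t * cos t * ?P k - sin t ^ k * sin t * ?P k
        - sin t ^ k * cos t * sin t * ?P (Suc k))
      - (real (k + 2) * sin t ^ (k + 1) * cos t * ?P (Suc k) - sin t ^ (k + 2) * sin t * ?P (Suc (Suc k)))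
    = real k * polar_quot l k t - real l * (real l + 1) * (sin t * polar l k t)"
  proof -
    have ode: "(sin t)\<^sup>2 * ?P (Suc (Suc k)) = 2 * (real k + 1) * cos t * ?P (Suc k)
        - (real l - real k) * (real l + real k + 1) * ?P k"
      using legendre_deriv_ode[of "cos t" l k] by (simp add: sin_squared_eq)
    have "sin t ^ (k + 2) * sin t * ?P (Suc (Suc k)) = sin t ^ (k + 1) * ((sin t)\<^sup>2 * ?P (Suc (Suc k)))"
      by (simp add: power2_eq_square)
    then have 1: "sin t ^ (k + 2) * sin t * ?P (Suc (Suc k)) = sin t ^ (k + 1) * (2 * (real k + 1) * cos t * ?P (Suc k)
        - (real l - real k) * (real l + real k + 1) * ?P k)"
      unfolding ode .
    \<comment> \<open>Replacing cos^2 by 1 - sin^2 isolates the term k * \<open>polar_quot\<close>,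
      the only one with the exponent k - 1.\<close>
    have 2: "real k * (real k * sin t ^ (k - 1) * cos t * cos t * ?P k)
      = real k * (real k * sin t ^ (k - 1) * ?P k) - real k * (real k * sin t ^ (k + 1) * ?P k)"
    proof (cases k)
      case (Suc n)
      have cc: "cos t * cos t = 1 - sin t * sin t"
        using sin_squared_eq[of t] by (simp add: power2_eq_square)
      have "sin t ^ n * (cos t * cos t) = sin t ^ n - sin t ^ (n + 2)"
        unfolding cc by (simp add: algebra_simps)
      then have "real k * real k * ?P k * (sin t ^ n * (cos t * cos t)) = real k * real k * ?P k * (sin t ^ n - sin t ^ (n + 2))"
        by simp
      then show ?thesis using Suc by (simp add: algebra_simps)
    qed simp
    show ?thesis
      unfolding polar_quot_def polar_def right_diff_distrib 1 2
      by (simp add: algebra_simps)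
  qed
  finally show ?thesis .
qed

lemma continuous_on_polar: "continuous_on S (polar l k)"
  unfolding polar_def by (intro continuous_intros continuous_on_poly)

lemma continuous_on_polar_deriv: "continuous_on S (polar_deriv l k)"
  unfolding polar_deriv_def by (intro continuous_intros continuous_on_poly)

lemma continuous_on_polar_quot: "continuous_on S (polar_quot l k)"
  unfolding polar_quot_def by (intro continuous_intros continuous_on_poly)

lemmas continuous_on_polars = continuous_on_polar continuous_on_polar_deriv continuous_on_polar_quot

section \<open>Integration by parts in the polar angle: orthogonality in l and norms\<close>

lemma FTC_real:
  assumes "a \<le> b" "\<And>t. (f has_real_derivative f' t) (at t within {a..b})"
  shows "(f' has_integral (f b - f a)) {a..b}"
  using assms by (intro fundamental_theorem_of_calculus)
    (auto simp: has_real_derivative_iff_has_vector_derivative)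

text \<open>The form in which integration by parts is applied: an antiderivative with equal end
  values makes two integrals proportional.\<close>

lemma integral_eq_of_has_integral_diff:
  fixes f g :: "real \<Rightarrow> real"
  assumes "((\<lambda>t. a * f t - b * g t) has_integral 0) S" "f integrable_on S" "g integrable_on S"
  shows "a * integral S f = b * integral S g"
proof -
  have "((\<lambda>t. a * f t - b * g t) has_integral (a * integral S f - b * integral S g)) S"
    by (intro has_integral_diff has_integral_mult_right integrable_integral assms)
  from has_integral_unique[OF assms(1) this] show ?thesis by simp
qed

(* Integrating d/dt (sin t * polar_deriv l k t * polar l' k t); the boundary terms carry sin. *)
lemma integral_polar_energy:
  "integral {0..pi} (\<lambda>t. sin t * (polar_deriv l k t * polar_deriv l' k t + polar_quot l k t * polar_quot l' k t))
    = real l * (real l + 1) * integral {0..pi} (\<lambda>t. sin t * (polar l k t * polar l' k t))"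
proof -
  let ?e = "\<lambda>t. sin t * (polar_deriv l k t * polar_deriv l' k t + polar_quot l k t * polar_quot l' k t)"
  let ?f = "\<lambda>t. sin t * (polar l k t * polar l' k t)"
  have "((\<lambda>t. (sin t * polar_deriv l k t) * polar l' k t) has_field_derivative
      ?e t - real l * (real l + 1) * ?f t) (at t within {0..pi})" for t
  proof -
    have "((\<lambda>t. (sin t * polar_deriv l k t) * polar l' k t) has_field_derivative
      (real k * polar_quot l k t - real l * (real l + 1) * (sin t * polar l k t)) * polar l' k t
      + polar_deriv l' k t * (sin t * polar_deriv l k t)) (at t within {0..pi})"
      by (intro DERIV_mult has_field_derivative_sin_polar_deriv has_field_derivative_polar)
    moreover have "(real k * polar_quot l k t - real l * (real l + 1) * (sin t * polar l k t)) * polar l' k t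
      + polar_deriv l' k t * (sin t * polar_deriv l k t) = ?e t - real l * (real l + 1) * ?f t"
      using sin_mult_polar_quot[of t l' k] by algebra
    ultimately show ?thesis by simp
  qed
  from FTC_real[OF _ this]
  have 0: "((\<lambda>t. ?e t - real l * (real l + 1) * ?f t) has_integral 0) {0..pi}"
    by simp
  have "?e integrable_on {0..pi}" "?f integrable_on {0..pi}"
    by (intro integrable_continuous_real continuous_intros continuous_on_polars)+
  with integral_eq_of_has_integral_diff[of 1 ?e _ ?f] 0 show ?thesis
    by simp
qed

lemma integral_polar_orthogonal:
  assumes "l \<noteq> l'"
  shows "integral {0..pi} (\<lambda>t. sin t * (polar l k t * polar l' k t)) = 0"
proof -
  have "real l * (real l + 1) * integral {0..pi} (\<lambda>t. sin t * (polar l k t * polar l' k t))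
    = real l' * (real l' + 1) * integral {0..pi} (\<lambda>t. sin t * (polar l k t * polar l' k t))"
    using integral_polar_energy[where k = k and l = l and l' = l']
      integral_polar_energy[where k = k and l = l' and l' = l]
    by (simp add: mult.commute)
  moreover have "real l * (real l + 1) - real l' * (real l' + 1) = (real l - real l') * (real l + real l' + 1)"
    by algebra
  moreover have "real l * (real l + 1) \<noteq> real l' * (real l' + 1)"
    using assms calculation(2)
    by (smt (verit) mult_eq_0_iff of_nat_0_le_iff of_nat_eq_iff)
  ultimately show ?thesis by simp
qed

text \<open>In x = cos t the equation reads ((1 - x^2)^(k+1) P^(k+1))' = - (l - k)(l + k + 1) (1 -
  x^2)^k P^(k), with P^(k) the k-th derivative of P_l. Testing it against P^(k) explains the
  antiderivative sin^(2k+2) P^(k) P^(k+1), which vanishes at both poles.\<close>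

lemma integral_polar_step:
  "integral {0..pi} (\<lambda>t. sin t * (polar l (Suc k) t)\<^sup>2)
    = (real l - real k) * (real l + real k + 1) * integral {0..pi} (\<lambda>t. sin t * (polar l k t)\<^sup>2)"
proof -
  let ?c = "(real l - real k) * (real l + real k + 1)"
  let ?e = "\<lambda>t. sin t * (polar l (Suc k) t)\<^sup>2" and ?f = "\<lambda>t. sin t * (polar l k t)\<^sup>2"
  have "((\<lambda>t. sin t ^ (2 * k + 2) * (poly (legendre_deriv l k) (cos t) * poly (legendre_deriv l (Suc k)) (cos t)))
      has_field_derivative ?c * ?f t - ?e t) (at t within {0..pi})" for t
  proof -
    let ?P = "\<lambda>k. poly (legendre_deriv l k) (cos t)"
    have "((\<lambda>t. sin t ^ Suc (2 * k + 1)) has_field_derivative real (2 * k + 2) * sin t ^ (2 * k + 1) * cos t)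
        (at t within {0..pi})"
      by (auto intro!: derivative_eq_intros simp del: power_Suc)
    then have "((\<lambda>t. sin t ^ (2 * k + 2)) has_field_derivative real (2 * k + 2) * sin t ^ (2 * k + 1) * cos t)
        (at t within {0..pi})"
      by simp
    from DERIV_mult[OF this DERIV_mult[OF has_field_derivative_legendre_cos has_field_derivative_legendre_cos]]
    have "((\<lambda>t. sin t ^ (2 * k + 2) * (poly (legendre_deriv l k) (cos t) * poly (legendre_deriv l (Suc k)) (cos t)))
      has_field_derivative
        real (2 * k + 2) * sin t ^ (2 * k + 1) * cos t * (?P k * ?P (Suc k))
        - sin t ^ (2 * k + 2) * (sin t * ?P (Suc k) * ?P (Suc k) + sin t * ?P (Suc (Suc k)) * ?P k)) (at t within {0..pi})"
      by (rule DERIV_cong) (simp add: algebra_simps)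
    moreover have "real (2 * k + 2) * sin t ^ (2 * k + 1) * cos t * (?P k * ?P (Suc k))
        - sin t ^ (2 * k + 2) * (sin t * ?P (Suc k) * ?P (Suc k) + sin t * ?P (Suc (Suc k)) * ?P k)
       = ?c * ?f t - ?e t"
    proof -
      have ode: "(sin t)\<^sup>2 * ?P (Suc (Suc k)) = 2 * (real k + 1) * cos t * ?P (Suc k)
          - ?c * ?P k"
        using legendre_deriv_ode[of "cos t" l k] by (simp add: sin_squared_eq)
      have "sin t ^ (2 * k + 2) * (sin t * ?P (Suc (Suc k)) * ?P k)
          = sin t ^ (2 * k + 1) * ?P k * ((sin t)\<^sup>2 * ?P (Suc (Suc k)))"
        by (simp add: power2_eq_square)
      then have "sin t ^ (2 * k + 2) * (sin t * ?P (Suc (Suc k)) * ?P k)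
          = sin t ^ (2 * k + 1) * ?P k * (2 * (real k + 1) * cos t * ?P (Suc k) - ?c * ?P k)"
        unfolding ode .
      moreover have pw: "sin t ^ (2 * k + 1) = sin t ^ k * sin t ^ k * sin t"
        "sin t ^ (2 * k + 2) = sin t ^ Suc k * sin t ^ Suc k"
        by (simp_all add: mult_2 power_add)
      moreover have f: "?f t = sin t ^ (2 * k + 1) * (?P k * ?P k)"
        unfolding polar_def power2_eq_square pw by (simp only: mult_ac)
      moreover have e: "?e t = sin t ^ (2 * k + 2) * (sin t * ?P (Suc k) * ?P (Suc k))"
        unfolding polar_def power2_eq_square pw by (simp only: mult_ac)
      ultimately show ?thesis
        unfolding f e
        by (simp add: algebra_simps)
    qed
    ultimately show ?thesis by simp
  qed
  from FTC_real[OF _ this]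
  have 0: "((\<lambda>t. ?c * ?f t - ?e t) has_integral 0) {0..pi}"
    by simp
  have "?e integrable_on {0..pi}" "?f integrable_on {0..pi}"
    by (intro integrable_continuous_real continuous_intros continuous_on_polars)+
  with integral_eq_of_has_integral_diff[of ?c ?f 1 ?e] 0 show ?thesis
    by simp
qed

text \<open>Wallis' recursion (2l + 3) J_(l+1) = (2l + 2) J_l, obtained from the derivative of - cos
  t sin^(2l+2) t, whose end values are zero.\<close>

lemma integral_sin_odd_power:
  "integral {0..pi} (\<lambda>t. sin t ^ (2 * l + 1)) = 2 ^ (2 * l + 1) * (fact l)\<^sup>2 / fact (2 * l + 1)"
proof (induction l)
  case 0
  have "((\<lambda>t. - cos t) has_real_derivative sin t) (at t within {0..pi})" for t
    by (auto intro!: derivative_eq_intros)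
  from FTC_real[OF _ this] have "(sin has_integral 2) {0..pi}"
    by simp
  then show ?case by (simp add: integral_unique)
next
  case (Suc l)
  let ?J = "\<lambda>l. integral {0..pi} (\<lambda>t. sin t ^ (2 * l + 1))"
  have "((\<lambda>t. - cos t * sin t ^ (2 * l + 2)) has_field_derivative
      (2 * real l + 3) * sin t ^ (2 * Suc l + 1) - (2 * real l + 2) * sin t ^ (2 * l + 1)) (at t within {0..pi})" for t
  proof -
    have "((\<lambda>t. - cos t * sin t ^ (2 * l + 2)) has_field_derivative
        sin t * sin t ^ (2 * l + 2) - real (2 * l + 2) * (sin t ^ (2 * l + 1) * (cos t * cos t))) (at t within {0..pi})"
      by (rule DERIV_cong[OF DERIV_mult[OF DERIV_minus[OF has_field_derivative_at_within[OF DERIV_cos]]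
              has_field_derivative_sin_power]])
        (simp add: algebra_simps)
    moreover have "cos t * cos t = 1 - sin t * sin t"
      using sin_squared_eq[of t] by (simp add: power2_eq_square)
    ultimately show ?thesis by (simp add: algebra_simps)
  qed
  from FTC_real[OF _ this]
  have 0: "((\<lambda>t. (2 * real l + 3) * sin t ^ (2 * Suc l + 1) - (2 * real l + 2) * sin t ^ (2 * l + 1)) has_integral 0) {0..pi}"
    by simp
  have "(\<lambda>t::real. sin t ^ n) integrable_on {0..pi}" for n
    by (intro integrable_continuous_real continuous_intros)
  then have "(2 * real l + 3) * ?J (Suc l) = (2 * real l + 2) * ?J l"
    by (intro integral_eq_of_has_integral_diff[OF 0])
  then have "?J (Suc l) = (2 * real l + 2) / (2 * real l + 3) * ?J l"
    by (simp add: field_simps add_eq_0_iff)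
  also have "\<dots> = 2 ^ (2 * Suc l + 1) * (fact (Suc l))\<^sup>2 / fact (2 * Suc l + 1)"
  proof -
    define A F G :: real where "A = 2 ^ (2 * l + 1)" and "F = (fact l)\<^sup>2" and "G = fact (2 * l + 1)"
    have "(2 :: real) ^ (2 * Suc l + 1) = 4 * A"
      by (simp add: A_def)
    moreover have "(fact (Suc l) :: real)\<^sup>2 = (real l + 1)\<^sup>2 * F"
      by (simp add: F_def power2_eq_square algebra_simps)
    moreover have "(fact (2 * Suc l + 1) :: real) = (2 * real l + 3) * (2 * (real l + 1)) * G"
      by (simp add: G_def algebra_simps)
    moreover have "2 * b / a * (A * F / G) = 4 * A * (b\<^sup>2 * F) / (a * (2 * b) * G)" if "b \<noteq> 0" for a b :: real
      using that by (simp add: power2_eq_square mult_ac)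
    from this[of "real l + 1" "2 * real l + 3"]
    have "(2 * real l + 2) / (2 * real l + 3) * (A * F / G)
        = 4 * A * ((real l + 1)\<^sup>2 * F) / ((2 * real l + 3) * (2 * (real l + 1)) * G)"
      by simp
    ultimately show ?thesis
      unfolding Suc A_def[symmetric] F_def[symmetric] G_def[symmetric] by metis
  qed
  finally show ?case .
qed

lemma integral_polar_norm:
  assumes "k \<le> l"
  shows "integral {0..pi} (\<lambda>t. sin t * (polar l k t)\<^sup>2)
    = 2 / (2 * real l + 1) * (fact (l + k) / fact (l - k))"
  using assms
proof (induction k rule: inc_induct)
  case base
  let ?c = "fact (2 * l) / (2 ^ l * fact l) :: real"
  have "sin t * (polar l l t)\<^sup>2 = ?c\<^sup>2 * sin t ^ (2 * l + 1)" for t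
    by (simp add: polar_def legendre_deriv_top power_mult_distrib power_divide power_even_eq)
  then have "integral {0..pi} (\<lambda>t. sin t * (polar l l t)\<^sup>2) = ?c\<^sup>2 * (2 ^ (2 * l + 1) * (fact l)\<^sup>2 / fact (2 * l + 1))"
    by (simp only: integral_mult_right integral_sin_odd_power)
  also have "\<dots> = 2 / (2 * real l + 1) * (fact (l + l) / fact (l - l))"
  proof -
    have "(G / (P * f))\<^sup>2 * (2 * P\<^sup>2 * f\<^sup>2 / (a * G)) = 2 / a * G" if "P \<noteq> 0" "f \<noteq> 0" "G \<noteq> 0" for a G P f :: real
      using that by (simp add: power2_eq_square mult_ac)
    from this[of "2 ^ l" "fact l" "fact (2 * l)" "2 * real l + 1"] show ?thesis
      by (simp add: power_even_eq mult_2[symmetric] add.commute[of 1 "2 * real l"])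
  qed
  finally show ?case .
next
  case (step k)
  let ?N = "\<lambda>k. integral {0..pi} (\<lambda>t. sin t * (polar l k t)\<^sup>2)"
  \<comment> \<open>In this step k < l; writing l = k + d + 1 resolves the natural subtractions
    inside the factorials.\<close>
  obtain d where d: "l = Suc (k + d)"
    using step.hyps less_iff_Suc_add by blast
  have a: "real l - real k \<noteq> 0" and b: "real l + real k + 1 \<noteq> 0"
    using d by simp_all
  have top: "(fact (l + Suc k) :: real) = (real l + real k + 1) * fact (l + k)"
    by (simp add: algebra_simps)
  have bot: "(fact (l - k) :: real) = (real l - real k) * fact (l - Suc k)"
    by (simp add: d)
  have "2 / (2 * real l + 1) * (fact (l + Suc k) / fact (l - Suc k)) = (real l - real k) * (real l + real k + 1) * ?N k"
    using step.IH integral_polar_step[where l = l and k = k] by simp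
  then have "(real l + real k + 1) * ((real l - real k) * ?N k)
      = (real l + real k + 1) * (2 / (2 * real l + 1) * (fact (l + k) / fact (l - Suc k)))"
    unfolding top by (simp add: mult_ac)
  then have "(real l - real k) * ?N k = 2 / (2 * real l + 1) * (fact (l + k) / fact (l - Suc k))"
    using b mult_left_cancel by blast
  then have "?N k = 2 / (2 * real l + 1) * (fact (l + k) / fact (l - Suc k)) / (real l - real k)"
    using a by (metis nonzero_mult_div_cancel_left)
  then show ?case
    unfolding bot by (simp add: mult_ac)
qed

section \<open>Trigonometric system\<close>

definition trig :: "int \<Rightarrow> real \<Rightarrow> real" where
  "trig m p = (if m = 0 then 1 else if m > 0 then sqrt 2 * cos (of_int m * p) else sqrt 2 * sin (of_int (- m) * p))"

text \<open>With cosines at m > 0 and sines at m < 0, differentiation exchanges m and -m by one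
  formula for all signs, m = 0 included.\<close>

lemma has_field_derivative_trig:
  "(trig m has_field_derivative - of_int m * trig (- m) p) (at p within S)"
proof -
  have "((\<lambda>p. sqrt 2 * cos (of_int m * p)) has_field_derivative - of_int m * (sqrt 2 * sin (of_int m * p))) (at p within S)"
    "((\<lambda>p. sqrt 2 * sin (of_int (-m) * p)) has_field_derivative - of_int m * (sqrt 2 * cos (of_int (-m) * p))) (at p within S)"
    by (auto intro!: derivative_eq_intros)
  then show ?thesis
    by (cases "m = 0"; cases "m > 0") (auto simp: trig_def[abs_def])
qed

lemma continuous_on_trig: "continuous_on S (trig m)"
  by (rule DERIV_continuous_on[OF has_field_derivative_trig])

lemma trig_periodic: "trig m (2 * pi) = trig m 0"
proof -
  have "cos (of_int m * (2 * pi)) = 1" "sin (of_int (-m) * (2 * pi)) = 0" for m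
    using cos_int_2pin[of m] sin_int_2pin[of "-m"] by (simp_all add: mult_ac)
  then show ?thesis by (simp add: trig_def)
qed

lemma trig_squares: "m \<noteq> 0 \<Longrightarrow> trig m p * trig m p + trig (- m) p * trig (- m) p = 2"
proof -
  have "(sqrt 2 * a) * (sqrt 2 * a) + (sqrt 2 * b) * (sqrt 2 * b) = 2" if "a\<^sup>2 + b\<^sup>2 = 1" for a b :: real
  proof -
    have "(sqrt 2 * a) * (sqrt 2 * a) + (sqrt 2 * b) * (sqrt 2 * b) = (sqrt 2)\<^sup>2 * (a\<^sup>2 + b\<^sup>2)"
      by (simp only: power2_eq_square distrib_left mult_ac)
    then show ?thesis using that by simp
  qed
  then show "m \<noteq> 0 \<Longrightarrow> ?thesis"
    by (auto simp: trig_def)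
qed

text \<open>Integration by parts (\<open>W\<close>) relates the pair (m, n) to (-m, -n). Used twice
  it gives zero when m^2 and n^2 differ. For m = n nonzero it equates the integrals of the two
  squares, whose sum is 4 pi. For m = -n nonzero the integrand is a multiple of the derivative of a
  square.\<close>

lemma integral_trig:
  "integral {0..2 * pi} (\<lambda>p. trig m p * trig n p) = (if m = n then 2 * pi else 0)"
proof -
  note D = has_field_derivative_trig
  have int: "(\<lambda>p. trig m p * trig n p) integrable_on {0..2 * pi}" for m n
    by (intro integrable_continuous_real continuous_intros continuous_on_trig)
  have W: "(of_int n ^ 2) * integral {0..2 * pi} (\<lambda>p. trig m p * trig n p)
      = (of_int m * of_int n) * integral {0..2 * pi} (\<lambda>p. trig (-m) p * trig (-n) p)" for m n
  proof -
    have "((\<lambda>p. trig m p * (- of_int n * trig (-n) p)) has_field_derivative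
        (of_int m * of_int n) * (trig (-m) p * trig (-n) p) - of_int n ^ 2 * (trig m p * trig n p))
        (at p within {0..2 * pi})" for p
      by (rule DERIV_cong[OF DERIV_mult[OF D DERIV_cmult[OF D]]]) (simp add: power2_eq_square algebra_simps)
    from FTC_real[OF _ this]
    have "((\<lambda>p. (of_int m * of_int n) * (trig (-m) p * trig (-n) p) - of_int n ^ 2 * (trig m p * trig n p)) has_integral 0) {0..2 * pi}"
      by (simp add: trig_periodic)
    from integral_eq_of_has_integral_diff[OF this int int] show ?thesis by simp
  qed
  have "m = n \<or> m = - n \<or> m\<^sup>2 \<noteq> n\<^sup>2"
    by (auto simp: power2_eq_iff)
  then consider "m = n" "m = 0" | "m = n" "m \<noteq> 0" | "m = - n" "m \<noteq> 0" | "m\<^sup>2 \<noteq> n\<^sup>2"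
    by force
  then show ?thesis
  proof cases
    case 1
    then show ?thesis by (simp add: trig_def)
  next
    case 2
    have "integral {0..2 * pi} (\<lambda>p. trig m p * trig m p) = integral {0..2 * pi} (\<lambda>p. trig (-m) p * trig (-m) p)"
      using W[of m m] 2 by (simp add: power2_eq_square)
    moreover have "integral {0..2 * pi} (\<lambda>p. trig m p * trig m p) + integral {0..2 * pi} (\<lambda>p. trig (-m) p * trig (-m) p)
       = integral {0..2 * pi} (\<lambda>p. 2)"
      unfolding Henstock_Kurzweil_Integration.integral_add[OF int int, symmetric] trig_squares[OF 2(2)] by simp
    ultimately show ?thesis using 2 by simp
  next
    case 3
    \<comment> \<open>The summand with factor 0 only gives the derivative the shape expected by
      \<open>integral_eq_of_has_integral_diff\<close>.\<close>
    have "((\<lambda>p. trig m p * trig m p) has_field_derivative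
        (- 2 * of_int m) * (trig m p * trig (-m) p) - 0 * (trig m p * trig n p)) (at p within {0..2 * pi})" for p
      by (rule DERIV_cong[OF DERIV_mult[OF D D]]) (simp add: algebra_simps)
    from FTC_real[OF _ this]
    have "((\<lambda>p. (- 2 * of_int m) * (trig m p * trig (-m) p) - 0 * (trig m p * trig n p)) has_integral 0) {0..2 * pi}"
      by (simp add: trig_periodic)
    from integral_eq_of_has_integral_diff[OF this int int] show ?thesis
      using 3 by auto
  next
    case 4
    then have "(real_of_int m)\<^sup>2 \<noteq> (real_of_int n)\<^sup>2"
      by (metis of_int_eq_iff of_int_power)
    moreover have "(of_int n ^ 2) * integral {0..2 * pi} (\<lambda>p. trig m p * trig n p)
      = (of_int m ^ 2) * integral {0..2 * pi} (\<lambda>p. trig m p * trig n p)"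
      using W[of n m] W[of m n] by (simp add: mult.commute)
    ultimately show ?thesis using 4 by auto
  qed
qed

text \<open>For k > 0 both factors vanish at the poles, so the derivative of their product
  integrates to 0. This is the cancellation behind the orthogonality of Psi_1 and Psi_2.\<close>

lemma integral_polar_mixed:
  assumes "k \<noteq> 0"
  shows "integral {0..pi} (\<lambda>t. polar l k t * polar_deriv l' k t) = - integral {0..pi} (\<lambda>t. polar_deriv l k t * polar l' k t)"
proof -
  have 0: "polar l k 0 = 0" "polar l k pi = 0" for l
    using assms by (simp_all add: polar_def)
  have "((\<lambda>t. polar l k t * polar l' k t) has_field_derivative
     1 * (polar l k t * polar_deriv l' k t) - (-1) * (polar_deriv l k t * polar l' k t)) (at t within {0..pi})" for t
    by (rule DERIV_cong[OF DERIV_mult[OF has_field_derivative_polar has_field_derivative_polar]]) simp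
  from FTC_real[OF _ this]
  have "((\<lambda>t. 1 * (polar l k t * polar_deriv l' k t) - (-1) * (polar_deriv l k t * polar l' k t)) has_integral 0) {0..pi}"
    by (simp add: 0)
  moreover have "(\<lambda>t. polar l k t * polar_deriv l' k t) integrable_on {0..pi}"
    "(\<lambda>t. polar_deriv l k t * polar l' k t) integrable_on {0..pi}"
    by (intro integrable_continuous_real continuous_intros continuous_on_polars)+
  ultimately show ?thesis
    using integral_eq_of_has_integral_diff[of 1 _ "-1"] by simp
qed

section \<open>Integration over the sphere\<close>

text \<open>The vector e_theta; together with \<open>azimuth_unit p\<close> (e_phi) and
  \<open>sphere_point (t, p)\<close> (e_r) it forms an orthonormal frame.\<close>

definition polar_unit :: "real \<Rightarrow> real \<Rightarrow> real ^ 3" where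
  "polar_unit t p = vector [cos t * cos p, cos t * sin p, - sin t]"

definition azimuth_unit :: "real \<Rightarrow> real ^ 3" where
  "azimuth_unit p = vector [- sin p, cos p, 0]"

lemma vector_3_eq_axis_sum:
  "(vector [a, b, c] :: real ^ 3) = a *\<^sub>R axis 1 1 + b *\<^sub>R axis 2 1 + c *\<^sub>R axis 3 1"
  by (simp add: vec_eq_iff forall_3 axis_def vector_3)

lemma norm_sphere_point [simp]: "norm (sphere_point z) = 1"
proof -
  have "(sin t * cos p) * (sin t * cos p) + (sin t * sin p) * (sin t * sin p) + cos t * cos t = 1" for t p :: real
  proof -
    have "(sin t * cos p) * (sin t * cos p) + (sin t * sin p) * (sin t * sin p) + cos t * cos t
      = (sin t)\<^sup>2 * ((sin p)\<^sup>2 + (cos p)\<^sup>2) + (cos t)\<^sup>2"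
      by (simp only: power2_eq_square distrib_left mult_ac add_ac)
    then show ?thesis by simp
  qed
  then show ?thesis
    by (cases z) (simp add: sphere_point_def norm_eq_sqrt_inner inner_vec_def sum_3 vector_3)
qed

lemma sphere_point_nonzero [simp]: "sphere_point z \<noteq> 0"
  using norm_sphere_point[of z] by (metis norm_zero zero_neq_one)

lemma sphere_point_eq_axis_sum:
  "sphere_point z = (sin (fst z) * cos (snd z)) *\<^sub>R axis 1 1 + (sin (fst z) * sin (snd z)) *\<^sub>R axis 2 1
     + cos (fst z) *\<^sub>R axis 3 1"
  by (simp add: sphere_point_def case_prod_beta vector_3_eq_axis_sum)

lemma continuous_on_sphere_point: "continuous_on S sphere_point"
  unfolding sphere_point_eq_axis_sum[abs_def] by (intro continuous_intros)

lemma has_vector_derivative_sphere_point: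
  "((\<lambda>t. sphere_point (t, p)) has_vector_derivative polar_unit t p) (at t)"
  "((\<lambda>p. sphere_point (t, p)) has_vector_derivative sin t *\<^sub>R azimuth_unit p) (at p)"
  unfolding sphere_point_eq_axis_sum[abs_def] polar_unit_def azimuth_unit_def vector_3_eq_axis_sum
    has_vector_derivative_def
  by (auto intro!: derivative_eq_intros simp: fun_eq_iff algebra_simps)

lemma sphere_frame_inner:
  fixes t p :: real and u v :: "real ^ 3"
  defines "x \<equiv> sphere_point (t, p)" and "e \<equiv> polar_unit t p" and "f \<equiv> azimuth_unit p"
  shows "u \<bullet> v = (u \<bullet> e) * (v \<bullet> e) + (u \<bullet> f) * (v \<bullet> f) + (u \<bullet> x) * (v \<bullet> x)"
proof -
  \<comment> \<open>Sines and cosines become variables subject only to s^2 + c^2 = 1, so the claim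
    is a polynomial identity modulo two relations, within reach of \<open>algebra\<close>.\<close>
  have *: "a1 * b1 + a2 * b2 + a3 * b3 =
     (a1 * (ct * cp) + a2 * (ct * sp) + a3 * (- st)) * (b1 * (ct * cp) + b2 * (ct * sp) + b3 * (- st))
     + (a1 * (- sp) + a2 * cp + a3 * 0) * (b1 * (- sp) + b2 * cp + b3 * 0)
     + (a1 * (st * cp) + a2 * (st * sp) + a3 * ct) * (b1 * (st * cp) + b2 * (st * sp) + b3 * ct)"
    if "st * st + ct * ct = 1" "sp * sp + cp * cp = 1" for a1 a2 a3 b1 b2 b3 st ct sp cp :: real
    using that by algebra
  show ?thesis
    unfolding x_def e_def f_def sphere_point_def polar_unit_def azimuth_unit_def inner_vec_def sum_3
      vector_3 inner_real_def case_prod_conv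
    by (rule *) (simp_all flip: power2_eq_square)
qed

text \<open>Expresses e_phi x e_r = e_theta and e_theta x e_r = - e_phi in components.\<close>

lemma sphere_frame_cross:
  fixes t p :: real and u v :: "real ^ 3"
  defines "x \<equiv> sphere_point (t, p)" and "e \<equiv> polar_unit t p" and "f \<equiv> azimuth_unit p"
  shows "cross3 u x \<bullet> v = (u \<bullet> f) * (v \<bullet> e) - (u \<bullet> e) * (v \<bullet> f)"
proof -
  have *: "(a2 * ct - st * sp * a3) * b1 + (a3 * (st * cp) - ct * a1) * b2 + (a1 * (st * sp) - st * cp * a2) * b3 =
     (a1 * (- sp) + a2 * cp + a3 * 0) * (b1 * (ct * cp) + b2 * (ct * sp) + b3 * (- st))
     - (a1 * (ct * cp) + a2 * (ct * sp) + a3 * (- st)) * (b1 * (- sp) + b2 * cp + b3 * 0)"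
    if "st * st + ct * ct = 1" "sp * sp + cp * cp = 1" for a1 a2 a3 b1 b2 b3 st ct sp cp :: real
    using that by algebra
  show ?thesis
    unfolding x_def e_def f_def sphere_point_def polar_unit_def azimuth_unit_def inner_vec_def sum_3
      vector_3 inner_real_def case_prod_conv cross_components
    by (rule *) (simp_all flip: power2_eq_square)
qed

section \<open>Harmonics and their gradients in spherical coordinates\<close>

lemma azimuthal_scale: "azimuthal m (of_real a * w) = a * azimuthal m w"
  by (simp add: azimuthal_def)

lemma sph_harm_sphere_point:
  "sph_harm l m (sphere_point (t, p)) = harm_const l (nat \<bar>m\<bar>) * (polar l (nat \<bar>m\<bar>) t * trig m p)"
proof -
  let ?k = "nat \<bar>m\<bar>"
  have "plane (sphere_point (t, p)) = of_real (sin t) * cis p"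
    by (simp add: plane_def sphere_point_def vector_3 complex_eq_iff)
  then have "plane (sphere_point (t, p)) ^ ?k = of_real (sin t ^ ?k) * cis (of_int \<bar>m\<bar> * p)"
    by (simp add: power_mult_distrib Complex.DeMoivre)
  moreover have "azimuthal m (cis (of_int \<bar>m\<bar> * p)) = trig m p"
    by (simp add: azimuthal_def trig_def)
  ultimately have "azimuthal m (plane (sphere_point (t, p)) ^ ?k) = sin t ^ ?k * trig m p"
    by (simp only: azimuthal_scale)
  moreover have "sphere_point (t, p) $ 3 = cos t"
    by (simp add: sphere_point_def vector_3)
  ultimately show ?thesis
    by (simp add: sph_harm_eq_harm_ext harm_ext_def polar_def)
qed

lemma has_derivative_grad_sph_harm:
  assumes "x \<noteq> 0"
  shows "(sph_harm l m has_derivative (\<lambda>v. grad (sph_harm l m) x \<bullet> v)) (at x)"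
  unfolding grad_sph_harm_inner[OF assms] by (rule has_derivative_sph_harm[OF assms])

lemma grad_sph_harm_polar_unit:
  "grad (sph_harm l m) (sphere_point (t, p)) \<bullet> polar_unit t p
    = harm_const l (nat \<bar>m\<bar>) * (polar_deriv l (nat \<bar>m\<bar>) t * trig m p)"
proof -
  have "((sph_harm l m \<circ> (\<lambda>t. sphere_point (t, p))) has_vector_derivative
      grad (sph_harm l m) (sphere_point (t, p)) \<bullet> polar_unit t p) (at t)"
    by (rule vector_derivative_diff_chain_within[OF has_vector_derivative_sphere_point(1)
          has_derivative_at_withinI[OF has_derivative_grad_sph_harm]]) simp
  moreover have "sph_harm l m \<circ> (\<lambda>t. sphere_point (t, p)) =
      (\<lambda>t. harm_const l (nat \<bar>m\<bar>) * (polar l (nat \<bar>m\<bar>) t * trig m p))"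
    by (simp add: fun_eq_iff sph_harm_sphere_point)
  ultimately have "((\<lambda>t. harm_const l (nat \<bar>m\<bar>) * (polar l (nat \<bar>m\<bar>) t * trig m p)) has_real_derivative
      grad (sph_harm l m) (sphere_point (t, p)) \<bullet> polar_unit t p) (at t)"
    by (simp add: has_real_derivative_iff_has_vector_derivative)
  moreover have "((\<lambda>t. harm_const l (nat \<bar>m\<bar>) * (polar l (nat \<bar>m\<bar>) t * trig m p)) has_real_derivative
      harm_const l (nat \<bar>m\<bar>) * (polar_deriv l (nat \<bar>m\<bar>) t * trig m p)) (at t)"
    by (intro DERIV_cmult DERIV_cmult_right has_field_derivative_polar)
  ultimately show ?thesis by (rule DERIV_unique)
qed

text \<open>A circle of latitude is traversed with velocity sin t e_phi, so the chain rule yields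
  the component only up to the factor sin t.\<close>

lemma grad_sph_harm_azimuth_unit:
  "sin t * (grad (sph_harm l m) (sphere_point (t, p)) \<bullet> azimuth_unit p)
    = - of_int m * harm_const l (nat \<bar>m\<bar>) * (polar l (nat \<bar>m\<bar>) t * trig (- m) p)"
proof -
  have "((sph_harm l m \<circ> (\<lambda>p. sphere_point (t, p))) has_vector_derivative
      grad (sph_harm l m) (sphere_point (t, p)) \<bullet> (sin t *\<^sub>R azimuth_unit p)) (at p)"
    by (rule vector_derivative_diff_chain_within[OF has_vector_derivative_sphere_point(2)
          has_derivative_at_withinI[OF has_derivative_grad_sph_harm]]) simp
  moreover have "sph_harm l m \<circ> (\<lambda>p. sphere_point (t, p)) =
      (\<lambda>p. harm_const l (nat \<bar>m\<bar>) * (polar l (nat \<bar>m\<bar>) t * trig m p))"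
    by (simp add: fun_eq_iff sph_harm_sphere_point)
  ultimately have "((\<lambda>p. harm_const l (nat \<bar>m\<bar>) * (polar l (nat \<bar>m\<bar>) t * trig m p)) has_real_derivative
      sin t * (grad (sph_harm l m) (sphere_point (t, p)) \<bullet> azimuth_unit p)) (at p)"
    by (simp add: has_real_derivative_iff_has_vector_derivative)
  moreover have "((\<lambda>p. harm_const l (nat \<bar>m\<bar>) * (polar l (nat \<bar>m\<bar>) t * trig m p)) has_real_derivative
      harm_const l (nat \<bar>m\<bar>) * (polar l (nat \<bar>m\<bar>) t * (- of_int m * trig (- m) p))) (at p)"
    by (intro DERIV_cmult has_field_derivative_trig)
  ultimately have "sin t * (grad (sph_harm l m) (sphere_point (t, p)) \<bullet> azimuth_unit p)
     = harm_const l (nat \<bar>m\<bar>) * (polar l (nat \<bar>m\<bar>) t * (- of_int m * trig (- m) p))"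
    by (rule DERIV_unique)
  then show ?thesis by simp
qed

text \<open>Since m = sgn m * k, the identity \<open>sin_mult_polar_quot\<close> supplies the sin t
  to be cancelled. The right-hand side stays continuous at the poles, where the cancellation itself
  is not possible.\<close>

lemma grad_sph_harm_azimuth_unit':
  assumes "sin t \<noteq> 0"
  shows "grad (sph_harm l m) (sphere_point (t, p)) \<bullet> azimuth_unit p
    = - harm_const l (nat \<bar>m\<bar>) * (polar_quot l (nat \<bar>m\<bar>) t * (sgn (of_int m) * trig (- m) p))"
proof -
  let ?k = "nat \<bar>m\<bar>"
  have "sin t * (grad (sph_harm l m) (sphere_point (t, p)) \<bullet> azimuth_unit p)
     = - of_int m * harm_const l ?k * (polar l ?k t * trig (- m) p)"
    by (rule grad_sph_harm_azimuth_unit)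
  also have "\<dots> = - harm_const l ?k * (sgn (of_int m) * trig (- m) p) * (real ?k * polar l ?k t)"
    by (simp add: sgn_if)
  also have "\<dots> = sin t * (- harm_const l ?k * (polar_quot l ?k t * (sgn (of_int m) * trig (- m) p)))"
    unfolding sin_mult_polar_quot[symmetric] by simp
  finally show ?thesis
    using assms mult_left_cancel by blast
qed

section \<open>The surface measure and integrals of separated functions\<close>

lemma space_sphere_measure [simp]: "space sphere_measure = sphere 0 1"
  by (simp add: sphere_measure_def space_restrict_space)

lemma sets_sphere_measure: "sets sphere_measure = sets (restrict_space borel (sphere 0 1))"
  by (simp add: sphere_measure_def)

lemma measurable_sphere_point:
  "sphere_point \<in> measurable (density lborel f) (restrict_space borel (sphere 0 1))"
  by (intro measurable_restrict_space2)
    (auto intro: borel_measurable_continuous_onI continuous_on_sphere_point)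

lemma borel_measurable_sphere_continuous:
  fixes f :: "real ^ 3 \<Rightarrow> 'b :: topological_space"
  assumes "continuous_on (sphere 0 1) f"
  shows "f \<in> borel_measurable sphere_measure"
  using borel_measurable_continuous_on_restrict[OF assms] sets_sphere_measure
  by (simp cong: measurable_cong_sets)

lemma borel_measurable_sphere_weight:
  "(\<lambda>z. indicator ({0..pi} \<times> {0..2 * pi}) z * sin (fst z)) \<in> borel_measurable (borel :: (real \<times> real) measure)"
  by (intro borel_measurable_times borel_measurable_indicator borel_closed closed_Times
      borel_measurable_continuous_onI continuous_intros)

lemma finite_measure_sphere: "finite_measure sphere_measure"
proof
  let ?K = "{0..pi} \<times> {0..2 * pi}"
  let ?w = "\<lambda>z. ennreal (indicator ?K z * sin (fst z))"
  have w: "?w \<in> borel_measurable borel"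
    by (intro measurable_compose[OF _ measurable_ennreal] borel_measurable_sphere_weight)
  have "emeasure sphere_measure (space sphere_measure) = emeasure (density lborel ?w) (sphere_point -` sphere 0 1 \<inter> UNIV)"
    using measurable_sphere_point[of ?w]
    by (simp add: sphere_measure_def case_prod_beta' emeasure_distr space_restrict_space sets_restrict_space_iff)
  also have "\<dots> \<le> emeasure (density lborel ?w) UNIV"
    by (intro emeasure_mono) auto
  also have "\<dots> = (\<integral>\<^sup>+ z. ?w z \<partial>lborel)"
    using w by (subst emeasure_density) auto
  also have "\<dots> \<le> (\<integral>\<^sup>+ z. indicator ?K z \<partial>lborel)"
    by (intro nn_integral_mono) (auto simp: indicator_def)
  also have "\<dots> = emeasure lborel (cbox (0, 0) (pi, 2 * pi))"
    by (subst nn_integral_indicator) (auto simp: cbox_Pair_eq intro!: borel_closed closed_Times)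
  also have "\<dots> < \<infinity>"
    by (rule emeasure_lborel_cbox_finite)
  finally show "emeasure sphere_measure (space sphere_measure) \<noteq> \<infinity>" by simp
qed

lemma integrable_sphere_continuous:
  fixes f :: "real ^ 3 \<Rightarrow> 'b :: {banach, second_countable_topology}"
  assumes "continuous_on (sphere 0 1) f"
  shows "integrable sphere_measure f"
proof -
  have "bounded (f ` sphere 0 1)"
    by (intro compact_imp_bounded compact_continuous_image assms) simp
  then obtain B where "\<And>x. x \<in> sphere 0 1 \<Longrightarrow> norm (f x) \<le> B"
    by (metis bounded_iff image_eqI)
  then show ?thesis
    by (intro finite_measure.integrable_const_bound[OF finite_measure_sphere, of _ B] AE_I2
        borel_measurable_sphere_continuous assms) simp
qed

lemma integral_lborel_box_product:
  fixes a b :: "real \<Rightarrow> real"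
  assumes a: "continuous_on {a0..a1} a" and b: "continuous_on {b0..b1} b"
  shows "(\<integral>z. indicator ({a0..a1} \<times> {b0..b1}) z *\<^sub>R (a (fst z) * b (snd z)) \<partial>lborel)
    = integral {a0..a1} a * integral {b0..b1} b"
    and "integrable lborel (\<lambda>z. indicator ({a0..a1} \<times> {b0..b1}) z *\<^sub>R (a (fst z) * b (snd z)))"
proof -
  let ?K = "{a0..a1} \<times> {b0..b1}"
  show i: "integrable lborel (\<lambda>z. indicator ?K z *\<^sub>R (a (fst z) * b (snd z)))"
    by (intro borel_integrable_compact compact_Times continuous_intros
        continuous_on_compose2[OF a] continuous_on_compose2[OF b]) auto
  have s: "(\<lambda>z. indicator ?K z *\<^sub>R (a (fst z) * b (snd z)))
      = (\<lambda>z. (indicator {a0..a1} (fst z) *\<^sub>R a (fst z)) * (indicator {b0..b1} (snd z) *\<^sub>R b (snd z)))"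
    by (auto simp: fun_eq_iff indicator_def)
  have "(\<integral>z. indicator ?K z *\<^sub>R (a (fst z) * b (snd z)) \<partial>lborel)
    = (\<integral>x. \<integral>y. (indicator {a0..a1} x *\<^sub>R a x) * (indicator {b0..b1} y *\<^sub>R b y) \<partial>lborel \<partial>lborel)"
    using lborel_pair.integral_fst'[of "\<lambda>z. (indicator {a0..a1} (fst z) *\<^sub>R a (fst z)) * (indicator {b0..b1} (snd z) *\<^sub>R b (snd z))"] i
    unfolding s lborel_prod by simp
  also have "\<dots> = (\<integral>x. indicator {a0..a1} x *\<^sub>R a x \<partial>lborel) * (\<integral>y. indicator {b0..b1} y *\<^sub>R b y \<partial>lborel)"
    by simp
  also have "\<dots> = integral {a0..a1} a * integral {b0..b1} b"
    using set_borel_integral_eq_integral(2)[of "{a0..a1}" a] set_borel_integral_eq_integral(2)[of "{b0..b1}" b]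
      borel_integrable_compact[OF _ a] borel_integrable_compact[OF _ b]
    by (simp add: set_lebesgue_integral_def set_integrable_def)
  finally show "(\<integral>z. indicator ?K z *\<^sub>R (a (fst z) * b (snd z)) \<partial>lborel)
    = integral {a0..a1} a * integral {b0..b1} b" .
qed

text \<open>Two products are allowed because an inner product of tangential fields has an e_theta
  and an e_phi part. Including the weight sin t in the hypothesis lets it absorb the quotients by
  sin t.\<close>

lemma sphere_integral_separated:
  fixes g :: "real ^ 3 \<Rightarrow> real"
  assumes g: "continuous_on (sphere 0 1) g"
    and a: "continuous_on {0..pi} a" "continuous_on {0..pi} a'"
    and b: "continuous_on {0..2 * pi} b" "continuous_on {0..2 * pi} b'"
    and eq: "\<And>t p. sin t * g (sphere_point (t, p)) = a t * b p + a' t * b' p"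
  shows "(\<integral>x. g x \<partial>sphere_measure) = integral {0..pi} a * integral {0..2 * pi} b + integral {0..pi} a' * integral {0..2 * pi} b'"
proof -
  let ?K = "{0..pi} \<times> {0..2 * pi}"
  have m: "g \<in> borel_measurable (restrict_space borel (sphere 0 1))"
    by (rule borel_measurable_continuous_on_restrict[OF g])
  have m': "(\<lambda>z. g (sphere_point z)) \<in> borel_measurable lborel"
    using borel_measurable_continuous_onI[OF continuous_on_compose2[OF g continuous_on_sphere_point[of UNIV]]]
    by (simp add: image_subset_iff)
  have "(\<integral>x. g x \<partial>sphere_measure)
    = (\<integral>z. g (sphere_point z) \<partial>density lborel (\<lambda>z. ennreal (indicator ?K z * sin (fst z))))"
    unfolding sphere_measure_def case_prod_beta' fst_conv snd_conv prod.collapse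
    by (rule integral_distr[OF measurable_sphere_point m])
  \<comment> \<open>The truncation of negative values by \<open>ennreal\<close> has no effect: sin
    is nonnegative on [0, pi], and the indicator is 0 elsewhere.\<close>
  also have "\<dots> = (\<integral>z. (indicator ?K z * sin (fst z)) *\<^sub>R g (sphere_point z) \<partial>lborel)"
    using m' borel_measurable_sphere_weight
    by (intro integral_density AE_I2) (auto simp: sin_ge_zero indicator_def[of _ "_ :: real \<times> real"])
  also have "\<dots> = (\<integral>z. indicator ?K z *\<^sub>R (a (fst z) * b (snd z)) + indicator ?K z *\<^sub>R (a' (fst z) * b' (snd z)) \<partial>lborel)"
  proof -
    have "(indicator ?K z * sin (fst z)) *\<^sub>R g (sphere_point z)
      = indicator ?K z *\<^sub>R (a (fst z) * b (snd z)) + indicator ?K z *\<^sub>R (a' (fst z) * b' (snd z))" for z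
      using eq[of "fst z" "snd z"] by (simp add: mult.assoc distrib_left[symmetric])
    then show ?thesis by simp
  qed
  also have "\<dots> = integral {0..pi} a * integral {0..2 * pi} b + integral {0..pi} a' * integral {0..2 * pi} b'"
    using integral_lborel_box_product[OF a(1) b(1)] integral_lborel_box_product[OF a(2) b(2)]
    by simp
  finally show ?thesis .
qed

section \<open>Orthonormality of the vector spherical harmonics\<close>

text \<open>Normalisation of the scalar harmonics: 2 pi is the azimuthal integral of the square of
  \<open>trig\<close>.\<close>

lemma harm_const_norm:
  assumes "k \<le> l"
  shows "harm_const l k * harm_const l k * (2 * pi) * integral {0..pi} (\<lambda>t. sin t * (polar l k t * polar l k t)) = 1"
proof -
  have "0 \<le> (2 * real l + 1) / (4 * pi) * (fact (l - k) / fact (l + k))"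
    by simp
  then have C: "harm_const l k * harm_const l k = (2 * real l + 1) / (4 * pi) * (fact (l - k) / fact (l + k))"
    unfolding harm_const_def by (rule real_sqrt_mult_self[THEN trans, OF abs_of_nonneg])
  have "a / (4 * pi) * (x / y) * (2 * pi) * (2 / a * (y / x)) = 1" if "a \<noteq> 0" "x \<noteq> 0" "y \<noteq> 0" for a x y :: real
    using that by (simp add: field_simps)
  from this[of "2 * real l + 1" "fact (l - k)" "fact (l + k)"] show ?thesis
    using integral_polar_norm[OF assms] by (simp add: C power2_eq_square)
qed

lemma integral_grad_sph_harm_inner:
  assumes "\<bar>m\<bar> \<le> int l"
  shows "(\<integral>x. grad (sph_harm l m) x \<bullet> grad (sph_harm l' m') x \<partial>sphere_measure)
    = (if (l, m) = (l', m') then real l * (real l + 1) else 0)"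
proof -
  let ?k = "nat \<bar>m\<bar>" and ?k' = "nat \<bar>m'\<bar>"
  let ?c = "harm_const l ?k * harm_const l' ?k'" and ?s = "sgn (of_int m) * sgn (of_int m') :: real"
  let ?D = "\<lambda>t. sin t * (polar_deriv l ?k t * polar_deriv l' ?k' t)"
  let ?Q = "\<lambda>t. sin t * (polar_quot l ?k t * polar_quot l' ?k' t)"
  have "(\<integral>x. grad (sph_harm l m) x \<bullet> grad (sph_harm l' m') x \<partial>sphere_measure)
     = integral {0..pi} (\<lambda>t. ?c * ?D t) * integral {0..2 * pi} (\<lambda>p. trig m p * trig m' p)
     + integral {0..pi} (\<lambda>t. ?c * ?s * ?Q t) * integral {0..2 * pi} (\<lambda>p. trig (- m) p * trig (- m') p)"
  proof (rule sphere_integral_separated)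
    fix t p
    let ?u = "grad (sph_harm l m) (sphere_point (t, p))" and ?v = "grad (sph_harm l' m') (sphere_point (t, p))"
    show "sin t * (?u \<bullet> ?v) = ?c * ?D t * (trig m p * trig m' p) + ?c * ?s * ?Q t * (trig (- m) p * trig (- m') p)"
    \<comment> \<open>At the poles the weight makes both sides zero, so the formula for the e_phi
      component is needed only away from them.\<close>
    proof (cases "sin t = 0")
      case False
      have "?u \<bullet> sphere_point (t, p) = 0"
        by (simp add: grad_sph_harm_radial)
      then show ?thesis
        unfolding sphere_frame_inner[of ?u ?v t p] grad_sph_harm_polar_unit grad_sph_harm_azimuth_unit'[OF False]
        by (simp add: algebra_simps)
    qed simp
  qed (intro continuous_intros continuous_on_grad_sph_harm continuous_on_polars continuous_on_trig)+
  also have "\<dots> = ?c * (integral {0..pi} ?D * (if m = m' then 2 * pi else 0)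
      + ?s * integral {0..pi} ?Q * (if m = m' then 2 * pi else 0))"
    unfolding integral_trig Henstock_Kurzweil_Integration.integral_mult_right by (simp add: algebra_simps)
  also have "\<dots> = (if (l, m) = (l', m') then real l * (real l + 1) else 0)"
  proof (cases "m = m'")
    case True
    have k: "?k \<le> l"
      using assms by auto
    \<comment> \<open>For m = m' the product of signs is 1 unless m = 0, and then
      \<open>polar_quot\<close> is zero by its factor k.\<close>
    have q: "?s * integral {0..pi} ?Q = integral {0..pi} ?Q"
    proof (cases "m = 0")
      case True
      then show ?thesis by (simp add: polar_quot_def)
    qed (use True in \<open>simp add: sgn_if\<close>)
    have "integral {0..pi} ?D + integral {0..pi} ?Q = integral {0..pi} (\<lambda>t. ?D t + ?Q t)"
      by (intro Henstock_Kurzweil_Integration.integral_add[symmetric] integrable_continuous_real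
          continuous_intros continuous_on_polars)
    also have "\<dots> = real l * (real l + 1) * integral {0..pi} (\<lambda>t. sin t * (polar l ?k t * polar l' ?k t))"
      using integral_polar_energy[where k = ?k and l = l and l' = l'] True by (simp add: distrib_left)
    finally have e: "integral {0..pi} ?D + integral {0..pi} ?Q
       = real l * (real l + 1) * integral {0..pi} (\<lambda>t. sin t * (polar l ?k t * polar l' ?k t))" .
    have "?c * (integral {0..pi} ?D * (2 * pi) + ?s * integral {0..pi} ?Q * (2 * pi))
      = real l * (real l + 1) * (harm_const l ?k * harm_const l' ?k * (2 * pi)
          * integral {0..pi} (\<lambda>t. sin t * (polar l ?k t * polar l' ?k t)))"
      unfolding q distrib_right[symmetric] e using True by (simp add: mult_ac)
    also have "\<dots> = (if l = l' then real l * (real l + 1) else 0)"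
      using harm_const_norm[OF k] integral_polar_orthogonal[where l = l and l' = l' and k = ?k] by auto
    finally show ?thesis using True by simp
  qed simp
  finally show ?thesis .
qed

text \<open>Each product in \<open>sphere_frame_cross\<close> has exactly one e_phi component, which
  takes up the weight sin t, so no quotient arises. The azimuthal integrals leave only m' = -m;
  there the two terms cancel by \<open>integral_polar_mixed\<close>, or carry a factor m =
  0.\<close>

lemma integral_cross_grad_sph_harm_inner:
  "(\<integral>x. cross3 (grad (sph_harm l m) x) x \<bullet> grad (sph_harm l' m') x \<partial>sphere_measure) = 0"
proof -
  let ?k = "nat \<bar>m\<bar>" and ?k' = "nat \<bar>m'\<bar>"
  let ?c = "harm_const l ?k * harm_const l' ?k'"
  have "(\<integral>x. cross3 (grad (sph_harm l m) x) x \<bullet> grad (sph_harm l' m') x \<partial>sphere_measure)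
     = integral {0..pi} (\<lambda>t. (- of_int m * ?c) * (polar l ?k t * polar_deriv l' ?k' t))
         * integral {0..2 * pi} (\<lambda>p. trig (- m) p * trig m' p)
     + integral {0..pi} (\<lambda>t. (of_int m' * ?c) * (polar_deriv l ?k t * polar l' ?k' t))
         * integral {0..2 * pi} (\<lambda>p. trig m p * trig (- m') p)"
  proof (rule sphere_integral_separated)
    fix t p
    let ?u = "grad (sph_harm l m) (sphere_point (t, p))" and ?v = "grad (sph_harm l' m') (sphere_point (t, p))"
    have "sin t * (cross3 ?u (sphere_point (t, p)) \<bullet> ?v)
      = (sin t * (?u \<bullet> azimuth_unit p)) * (?v \<bullet> polar_unit t p) - (?u \<bullet> polar_unit t p) * (sin t * (?v \<bullet> azimuth_unit p))"
      unfolding sphere_frame_cross[of ?u t p ?v] by (simp add: algebra_simps)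
    then show "sin t * (cross3 ?u (sphere_point (t, p)) \<bullet> ?v)
      = (- of_int m * ?c) * (polar l ?k t * polar_deriv l' ?k' t) * (trig (- m) p * trig m' p)
      + (of_int m' * ?c) * (polar_deriv l ?k t * polar l' ?k' t) * (trig m p * trig (- m') p)"
      unfolding grad_sph_harm_polar_unit grad_sph_harm_azimuth_unit by (simp add: algebra_simps)
  qed (intro continuous_intros continuous_on_cross continuous_on_grad_sph_harm continuous_on_polars continuous_on_trig)+
  also have "\<dots> = 0"
  proof (cases "m' = - m \<and> m \<noteq> 0")
    case True
    then have "?k \<noteq> 0" "?k' = ?k" by auto
    then show ?thesis
      unfolding integral_trig Henstock_Kurzweil_Integration.integral_mult_right
      using True integral_polar_mixed[of ?k l l'] by simp
  next
    case False
    then show ?thesis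
      unfolding integral_trig by auto
  qed
  finally show ?thesis .
qed

lemma cross_inner_cross:
  "cross3 u x \<bullet> cross3 v x = (u \<bullet> v) * (x \<bullet> x) - (u \<bullet> x) * (v \<bullet> x)"
  by (simp add: cross3_simps)

lemma sum_cvec_cnj: "(\<Sum>i\<in>UNIV. cvec u $ i * cnj (cvec v $ i)) = complex_of_real (u \<bullet> v)"
  by (simp add: cvec_def inner_vec_def)

lemma vsh_real_sphere:
  assumes "norm x = 1"
  shows "vsh_real (Suc 0) l m x = (1 / sqrt (real l * (real l + 1))) *\<^sub>R cross3 (grad (sph_harm l m) x) x"
    and "vsh_real 2 l m x = (1 / sqrt (real l * (real l + 1))) *\<^sub>R grad (sph_harm l m) x"
  using assms by (simp_all add: vsh_real_def)

text \<open>Crossing with the unit normal is an isometry of the tangent plane, so the pair (1, 1)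
  leads to the same integral of gradients as (2, 2); the mixed pairs lead to the cross
  integral.\<close>

lemma L2_inner_Psi:
  assumes j: "j \<in> {1, 2}" "j' \<in> {1, 2}" and lm: "(l, m) \<in> harm_index" "(l', m') \<in> harm_index"
  shows "L2_inner (Psi j l m) (Psi j' l' m') = (if (j', l', m') = (j, l, m) then 1 else 0)"
proof -
  let ?c = "1 / sqrt (real l * (real l + 1))" and ?c' = "1 / sqrt (real l' * (real l' + 1))"
  let ?g = "grad (sph_harm l m)" and ?g' = "grad (sph_harm l' m')"
  have grad: "(\<integral>x. ?g x \<bullet> ?g' x \<partial>sphere_measure) = (if (l, m) = (l', m') then real l * (real l + 1) else 0)"
    using lm by (intro integral_grad_sph_harm_inner) (auto simp: harm_index_def)
  have norm: "?c * ?c * (real l * (real l + 1)) = 1"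
    using lm by (simp add: harm_index_def flip: real_sqrt_mult)
  have "L2_inner (Psi j l m) (Psi j' l' m')
     = complex_of_real (\<integral>x. vsh_real j l m x \<bullet> vsh_real j' l' m' x \<partial>sphere_measure)"
    by (simp add: L2_inner_def Psi_def sum_cvec_cnj)
  also have "(\<integral>x. vsh_real j l m x \<bullet> vsh_real j' l' m' x \<partial>sphere_measure)
     = (if (j', l', m') = (j, l, m) then 1 else 0)"
  proof -
    consider "j = 1" "j' = 1" | "j = 1" "j' = 2" | "j = 2" "j' = 1" | "j = 2" "j' = 2"
      using j by auto
    then show ?thesis
    proof cases
      case 1
      have "(\<integral>x. vsh_real j l m x \<bullet> vsh_real j' l' m' x \<partial>sphere_measure) = (\<integral>x. (?c * ?c') * (?g x \<bullet> ?g' x) \<partial>sphere_measure)"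
      proof (rule Bochner_Integration.integral_cong[OF refl])
        fix x assume "x \<in> space sphere_measure"
        then have "norm x = 1" "x \<noteq> 0" by auto
        then show "vsh_real j l m x \<bullet> vsh_real j' l' m' x = (?c * ?c') * (?g x \<bullet> ?g' x)"
          using 1 grad_sph_harm_radial[of x l m]
          by (simp add: vsh_real_sphere cross_inner_cross dot_square_norm)
      qed
      then show ?thesis
        using 1 grad norm by (auto simp del: times_divide_eq_left times_divide_eq_right)
    next
      case 2
      have "(\<integral>x. vsh_real j l m x \<bullet> vsh_real j' l' m' x \<partial>sphere_measure) = (\<integral>x. (?c * ?c') * (cross3 (?g x) x \<bullet> ?g' x) \<partial>sphere_measure)"
        using 2 by (intro Bochner_Integration.integral_cong[OF refl]) (simp add: vsh_real_sphere)
      then show ?thesis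
        using 2 integral_cross_grad_sph_harm_inner[of l m l' m'] by simp
    next
      case 3
      have "(\<integral>x. vsh_real j l m x \<bullet> vsh_real j' l' m' x \<partial>sphere_measure) = (\<integral>x. (?c * ?c') * (cross3 (?g' x) x \<bullet> ?g x) \<partial>sphere_measure)"
        using 3 by (intro Bochner_Integration.integral_cong[OF refl]) (simp add: vsh_real_sphere inner_commute)
      then show ?thesis
        using 3 integral_cross_grad_sph_harm_inner[of l' m' l m] by simp
    next
      case 4
      have "(\<integral>x. vsh_real j l m x \<bullet> vsh_real j' l' m' x \<partial>sphere_measure) = (\<integral>x. (?c * ?c') * (?g x \<bullet> ?g' x) \<partial>sphere_measure)"
        using 4 by (intro Bochner_Integration.integral_cong[OF refl]) (simp add: vsh_real_sphere)
      then show ?thesis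
        using 4 grad norm by (auto simp del: times_divide_eq_left times_divide_eq_right)
    qed
  qed
  finally show ?thesis by simp
qed

section \<open>Square-integrable tangential fields\<close>

text \<open>R is a linear relation whose domain contains N. The set of x with
  \<open>R x (A x)\<close> is a subspace, so a choice on a basis of the domain suffices. Vanishing
  on N later makes A respect equality almost everywhere, and U bounds the values of A even outside
  the domain of R.\<close>

lemma (in vector_space) linear_selection:
  assumes R0: "\<And>n. n \<in> N \<Longrightarrow> R n 0" and N: "subspace N"
    and Radd: "\<And>x y x' y'. R x y \<Longrightarrow> R x' y' \<Longrightarrow> R (x + x') (y + y')"
    and Rscale: "\<And>c x y. R x y \<Longrightarrow> R (scale c x) (scale c y)"
    and RU: "\<And>x y. R x y \<Longrightarrow> y \<in> U" and U: "subspace U"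
  shows "\<exists>A. Vector_Spaces.linear scale scale A \<and> (\<forall>n\<in>N. A n = 0) \<and> range A \<subseteq> U
    \<and> (\<forall>x. (\<exists>y. R x y) \<longrightarrow> R x (A x))"
proof -
  interpret vector_space_pair scale scale by unfold_locales
  define D where "D = {x. \<exists>y. R x y}"
  obtain B0 where B0: "B0 \<subseteq> N" "independent B0" "N \<subseteq> span B0"
    by (rule maximal_independent_subset)
  have "B0 \<subseteq> D"
    using B0(1) R0 by (auto simp: D_def)
  then obtain B where B: "B0 \<subseteq> B" "B \<subseteq> D" "independent B" "D \<subseteq> span B"
    using maximal_independent_subset_extend[OF _ B0(2)] by metis
  \<comment> \<open>The value 0 on \<open>B0\<close> is an admissible choice because of
    \<open>R0\<close>, and it forces A to vanish on the span of \<open>B0\<close>, which contains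
    N.\<close>
  define f where "f b = (if b \<in> B0 then 0 else SOME y. R b y)" for b
  have Rf: "R b (f b)" if "b \<in> B" for b
    using that B(2) B0(1) R0 by (auto simp: f_def D_def intro: someI)
  obtain A where A: "Vector_Spaces.linear scale scale A" "\<And>b. b \<in> B \<Longrightarrow> A b = f b" "range A = span (f ` B)"
    using linear_independent_extend_subspace[OF B(3), of f] by metis
  interpret A: Vector_Spaces.linear scale scale A by (rule A(1))
  have "span B0 \<subseteq> {x. A x = 0}"
    using B(1) A(2) by (intro span_minimal) (auto simp: f_def subspace_def A.add A.scale A.zero)
  moreover have "span (f ` B) \<subseteq> U"
    using Rf RU by (intro span_minimal U) auto
  moreover have "span B \<subseteq> {x. R x (A x)}"
    using Rf A(2) R0[OF subspace_0[OF N]] Radd Rscale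
    by (intro span_minimal) (auto simp: subspace_def A.add A.scale A.zero)
  ultimately show ?thesis
    using A(1,3) B0(3) B(4) unfolding D_def by (intro exI[of _ A]) blast
qed

section \<open>Closure of L2t under linear operations and linearity of the coefficients\<close>

lemma norm_vector_smult: "norm (c *s v) = norm c * norm v" for v :: "complex ^ 'n"
  by (simp add: norm_vec_def L2_set_def norm_mult power_mult_distrib real_sqrt_mult flip: sum_distrib_left)

lemma continuous_on_vector_smult:
  "continuous_on S f \<Longrightarrow> continuous_on S (\<lambda>x. c *s (f x :: complex ^ 'n))"
  unfolding vector_scalar_mult_def by (intro continuous_on_vec_lambda continuous_intros)

lemma borel_measurable_vector_smult:
  "f \<in> borel_measurable M \<Longrightarrow> (\<lambda>x. c *s (f x :: complex ^ 'n)) \<in> borel_measurable M"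
  by (erule measurable_compose)
    (intro borel_measurable_continuous_onI continuous_on_vector_smult continuous_intros)

lemma L2t_add:
  assumes "Y \<in> L2t" "Z \<in> L2t"
  shows "(\<lambda>x. Y x + Z x) \<in> L2t"
proof -
  have "norm ((norm (Y x + Z x))\<^sup>2) \<le> norm (2 * ((norm (Y x))\<^sup>2 + (norm (Z x))\<^sup>2))" for x
  proof -
    have "(norm (Y x + Z x))\<^sup>2 \<le> (norm (Y x) + norm (Z x))\<^sup>2"
      by (intro power_mono norm_triangle_ineq) simp
    also have "\<dots> \<le> 2 * ((norm (Y x))\<^sup>2 + (norm (Z x))\<^sup>2)"
      using zero_le_power2[of "norm (Y x) - norm (Z x)"] by (simp add: power2_sum power2_diff)
    finally show ?thesis by simp
  qed
  moreover have m: "(\<lambda>x. Y x + Z x) \<in> borel_measurable sphere_measure"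
    using assms unfolding L2t_def by (intro borel_measurable_add) simp_all
  moreover have "integrable sphere_measure (\<lambda>x. 2 * ((norm (Y x))\<^sup>2 + (norm (Z x))\<^sup>2))"
    using assms unfolding L2t_def
    by (intro integrable_mult_right Bochner_Integration.integrable_add) simp_all
  ultimately have "integrable sphere_measure (\<lambda>x. (norm (Y x + Z x))\<^sup>2)"
    by (intro Bochner_Integration.integrable_bound[OF _ borel_measurable_power[OF measurable_compose[OF m borel_measurable_norm]]] AE_I2)
  moreover have ae: "AE x in sphere_measure. (\<Sum>i\<in>UNIV. complex_of_real (x $ i) * Y x $ i) = 0"
    "AE x in sphere_measure. (\<Sum>i\<in>UNIV. complex_of_real (x $ i) * Z x $ i) = 0"
    using assms unfolding L2t_def by simp_all
  have "AE x in sphere_measure. (\<Sum>i\<in>UNIV. complex_of_real (x $ i) * (Y x + Z x) $ i) = 0"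
    using ae by eventually_elim (simp add: distrib_left sum.distrib)
  ultimately show ?thesis
    using m unfolding L2t_def by simp
qed

lemma L2t_smult:
  assumes "Y \<in> L2t"
  shows "(\<lambda>x. c *s Y x) \<in> L2t"
proof -
  have "AE x in sphere_measure. (\<Sum>i\<in>UNIV. complex_of_real (x $ i) * (c *s Y x) $ i) = 0"
  proof -
    have "(\<Sum>i\<in>UNIV. complex_of_real (x $ i) * (c *s Y x) $ i) = c * (\<Sum>i\<in>UNIV. complex_of_real (x $ i) * Y x $ i)" for x
      by (simp add: sum_distrib_left mult_ac)
    then show ?thesis
      using assms by (auto simp: L2t_def)
  qed
  then show ?thesis
    using assms by (auto simp: L2t_def norm_vector_smult power_mult_distrib intro: borel_measurable_vector_smult)
qed

lemma continuous_on_L2t: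
  assumes "continuous_on (sphere 0 1) Y"
    and "\<And>x. norm x = 1 \<Longrightarrow> (\<Sum>i\<in>UNIV. complex_of_real (x $ i) * Y x $ i) = 0"
  shows "Y \<in> L2t"
  using assms
  by (auto simp: L2t_def intro!: borel_measurable_sphere_continuous integrable_sphere_continuous
      continuous_intros AE_I2)

lemma Psi_in_L2t:
  assumes "j \<in> {1, 2}"
  shows "Psi j l m \<in> L2t"
proof (rule continuous_on_L2t[OF continuous_on_Psi])
  fix x :: "real ^ 3"
  assume "norm x = 1"
  then have "x \<bullet> vsh_real j l m x = 0"
    by (intro vsh_real_tangential assms) auto
  moreover have "(\<Sum>i\<in>UNIV. complex_of_real (x $ i) * Psi j l m x $ i) = complex_of_real (x \<bullet> vsh_real j l m x)"
    by (simp add: Psi_def cvec_def inner_vec_def)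
  ultimately show "(\<Sum>i\<in>UNIV. complex_of_real (x $ i) * Psi j l m x $ i) = 0"
    by simp
qed

lemma zero_in_L2t: "(\<lambda>x. 0) \<in> L2t"
  by (rule continuous_on_L2t) auto

text \<open>A crude componentwise bound, with 3 for the number of components; the sharp
  Cauchy-Schwarz constant is immaterial for the estimates below.\<close>

lemma norm_inner_cnj_le:
  "norm (\<Sum>i\<in>UNIV. v $ i * cnj (w $ i)) \<le> 3 * (norm v * norm w)" for v w :: "complex ^ 3"
proof -
  have "norm (\<Sum>i\<in>UNIV. v $ i * cnj (w $ i)) \<le> (\<Sum>i\<in>(UNIV :: 3 set). norm v * norm w)"
    by (intro order_trans[OF norm_sum] sum_mono)
      (auto simp: norm_mult intro!: mult_mono Finite_Cartesian_Product.norm_nth_le)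
  then show ?thesis by simp
qed

lemma Psi_bounded:
  obtains B where "B > 0" "\<And>x. norm x = 1 \<Longrightarrow> norm (Psi j l m x) \<le> B"
proof -
  have "bounded (Psi j l m ` sphere 0 1)"
    by (intro compact_imp_bounded compact_continuous_image continuous_on_Psi) simp
  then obtain B where "B > 0" "\<forall>y\<in>Psi j l m ` sphere 0 1. norm y \<le> B"
    unfolding bounded_pos by blast
  then show thesis by (intro that[of B]) auto
qed

lemma borel_measurable_vec_component:
  "f \<in> borel_measurable M \<Longrightarrow> (\<lambda>x. (f x :: complex ^ 'n) $ i) \<in> borel_measurable M"
  by (erule measurable_compose) (intro borel_measurable_continuous_onI continuous_intros)

text \<open>The vector harmonic is bounded on the sphere, and |Y| <= 1 + |Y|^2 turns square
  integrability into integrability because the measure is finite.\<close>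

lemma integrable_inner_Psi:
  assumes "Y \<in> L2t"
  shows "integrable sphere_measure (\<lambda>x. \<Sum>i\<in>UNIV. Y x $ i * cnj (Psi j l m x $ i))"
proof -
  obtain B where B: "B > 0" "\<And>x. norm x = 1 \<Longrightarrow> norm (Psi j l m x) \<le> B"
    using Psi_bounded by blast
  show ?thesis
  proof (rule Bochner_Integration.integrable_bound)
    show "integrable sphere_measure (\<lambda>x. 3 * B * (1 + (norm (Y x))\<^sup>2))"
      using assms unfolding L2t_def
      by (intro integrable_mult_right Bochner_Integration.integrable_add
          finite_measure.integrable_const[OF finite_measure_sphere]) simp
    have "Y \<in> borel_measurable sphere_measure" "Psi j l m \<in> borel_measurable sphere_measure"
      using assms by (auto simp: L2t_def intro: borel_measurable_sphere_continuous continuous_on_Psi)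
    then show "(\<lambda>x. \<Sum>i\<in>UNIV. Y x $ i * cnj (Psi j l m x $ i)) \<in> borel_measurable sphere_measure"
      by (intro borel_measurable_sum borel_measurable_times borel_measurable_vec_component
          measurable_compose[OF borel_measurable_vec_component borel_measurable_continuous_onI[of cnj]]
          continuous_intros)
    show "AE x in sphere_measure. norm (\<Sum>i\<in>UNIV. Y x $ i * cnj (Psi j l m x $ i)) \<le> norm (3 * B * (1 + (norm (Y x))\<^sup>2))"
    proof (rule AE_I2)
      fix x assume "x \<in> space sphere_measure"
      then have "norm (\<Sum>i\<in>UNIV. Y x $ i * cnj (Psi j l m x $ i)) \<le> 3 * (norm (Y x) * B)"
        by (intro order_trans[OF norm_inner_cnj_le] mult_mono B) auto
      also have "norm (Y x) \<le> 1 + (norm (Y x))\<^sup>2"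
      proof -
        have "2 * norm (Y x) \<le> 1 + (norm (Y x))\<^sup>2"
          using zero_le_power2[of "norm (Y x) - 1"] by (simp add: power2_diff)
        then show ?thesis
          using norm_ge_zero[of "Y x"] by linarith
      qed
      then have "3 * (norm (Y x) * B) \<le> 3 * ((1 + (norm (Y x))\<^sup>2) * B)"
        using B(1) by (intro mult_left_mono mult_right_mono) auto
      also have "\<dots> = norm (3 * B * (1 + (norm (Y x))\<^sup>2))"
        using B(1) by (simp add: abs_mult)
      finally show "norm (\<Sum>i\<in>UNIV. Y x $ i * cnj (Psi j l m x $ i)) \<le> norm (3 * B * (1 + (norm (Y x))\<^sup>2))" .
    qed
  qed
qed

lemma L2_inner_add:
  assumes "Y \<in> L2t" "Z \<in> L2t"
  shows "L2_inner (\<lambda>x. Y x + Z x) (Psi j l m) = L2_inner Y (Psi j l m) + L2_inner Z (Psi j l m)"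
  unfolding L2_inner_def
  using integrable_inner_Psi[OF assms(1), of j l m] integrable_inner_Psi[OF assms(2), of j l m]
  by (simp add: distrib_right sum.distrib)

lemma L2_inner_smult: "L2_inner (\<lambda>x. c *s Y x) W = c * L2_inner Y W"
  unfolding L2_inner_def by (simp add: mult.assoc flip: sum_distrib_left)

lemma L2_inner_null:
  assumes "AE x in sphere_measure. Y x = 0"
  shows "L2_inner Y W = 0"
  unfolding L2_inner_def by (rule integral_eq_zero_AE) (use assms in auto)

section \<open>The boundary condition\<close>

lemma ccross_eq_0_iff:
  "ccross x w = 0 \<longleftrightarrow> cross3 x (\<chi> i. Re (w $ i)) = 0 \<and> cross3 x (\<chi> i. Im (w $ i)) = 0"
  by (auto simp: ccross_def cvec_def vec_eq_iff complex_eq_iff)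

lemma ccross_radial: "ccross x (c *s cvec (s *\<^sub>R x)) = 0"
proof -
  have "(\<chi> i. Re ((c *s cvec (s *\<^sub>R x)) $ i)) = (Re c * s) *\<^sub>R x"
    "(\<chi> i. Im ((c *s cvec (s *\<^sub>R x)) $ i)) = (Im c * s) *\<^sub>R x"
    by (simp_all add: cvec_def vec_eq_iff)
  then show ?thesis
    by (simp add: ccross_eq_0_iff cross_mult_right)
qed

text \<open>A vector w with x cross w = 0 is normal. For real and imaginary parts v, Lagrange's
  identity for (v cross x) . (u cross x) reduces to v . u = 0.\<close>

lemma inner_eq_0_if_ccross_eq_0:
  assumes "ccross x w = 0" "norm x = 1" "x \<bullet> u = 0"
  shows "(\<Sum>i\<in>UNIV. w $ i * cnj (cvec u $ i)) = 0"
proof -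
  have *: "v \<bullet> u = 0" if "cross3 x v = 0" for v
  proof -
    have "cross3 v x = 0"
      using that cross_skew[of v x] by simp
    then have "(v \<bullet> u) * (x \<bullet> x) - (v \<bullet> x) * (u \<bullet> x) = 0"
      using cross_inner_cross[of v x u] by simp
    then show ?thesis
      using assms by (simp add: inner_commute[of u] dot_square_norm)
  qed
  have "(\<chi> i. Re (w $ i)) \<bullet> u = 0" "(\<chi> i. Im (w $ i)) \<bullet> u = 0"
    using assms(1) * by (auto simp: ccross_eq_0_iff)
  then show ?thesis
    by (simp add: complex_eq_iff cvec_def inner_vec_def)
qed

section \<open>Convergence of the series and dependence on the coefficients alone\<close>

lemma Cinf_summable_cong:
  assumes "\<And>i. i \<in> I \<Longrightarrow> f i = g i" "Cinf_summable M f I"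
  shows "Cinf_summable M g I"
  unfolding Cinf_summable_def
proof (intro allI impI)
  fix "is" K assume "compact K \<and> K \<subseteq> M"
  with assms(2) obtain h where h: "uniform_limit K (\<lambda>F. partials is (\<lambda>x. \<Sum>i\<in>F. f i x)) h (finite_subsets_at_top I)"
    unfolding Cinf_summable_def by blast
  have "\<forall>\<^sub>F F in finite_subsets_at_top I. (\<lambda>x. \<Sum>i\<in>F. f i x) = (\<lambda>x. \<Sum>i\<in>F. g i x)"
    using eventually_finite_subsets_at_top_weakI[of I "\<lambda>F. (\<lambda>x. \<Sum>i\<in>F. f i x) = (\<lambda>x. \<Sum>i\<in>F. g i x)"] assms(1)
    by (auto simp: fun_eq_iff subset_eq intro!: sum.cong)
  then have "\<forall>\<^sub>F F in finite_subsets_at_top I. \<forall>x\<in>K.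
      partials is (\<lambda>x. \<Sum>i\<in>F. f i x) x = partials is (\<lambda>x. \<Sum>i\<in>F. g i x) x"
    by eventually_elim simp
  from uniform_limit_cong[OF this] h
  show "\<exists>h. uniform_limit K (\<lambda>F. partials is (\<lambda>x. \<Sum>i\<in>F. g i x)) h (finite_subsets_at_top I)"
    by blast
qed

lemma Cinf_summable_single:
  assumes "i0 \<in> I" "\<And>i x. i \<in> I \<Longrightarrow> i \<noteq> i0 \<Longrightarrow> f i x = 0"
  shows "Cinf_summable M f I"
  unfolding Cinf_summable_def
proof (intro allI impI)
  fix "is" K assume "compact K \<and> K \<subseteq> M"
  have "\<forall>\<^sub>F F in finite_subsets_at_top I. finite F \<and> {i0} \<subseteq> F \<and> F \<subseteq> I"
    using assms(1) unfolding eventually_finite_subsets_at_top by (intro exI[of _ "{i0}"]) auto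
  then have "\<forall>\<^sub>F F in finite_subsets_at_top I. (\<lambda>x. \<Sum>i\<in>F. f i x) = f i0"
  proof eventually_elim
    case (elim F)
    show ?case
    proof
      fix x
      have "(\<Sum>i\<in>F. f i x) = (\<Sum>i\<in>{i0}. f i x)"
        using elim assms(2) by (intro sum.mono_neutral_right) auto
      then show "(\<Sum>i\<in>F. f i x) = f i0 x" by simp
    qed
  qed
  then have "\<forall>\<^sub>F F in finite_subsets_at_top I. \<forall>x\<in>K. partials is (f i0) x = partials is (\<lambda>x. \<Sum>i\<in>F. f i x) x"
    by eventually_elim simp
  from uniform_limit_cong[OF this, of "partials is (f i0)" "partials is (f i0)"]
  show "\<exists>g. uniform_limit K (\<lambda>F. partials is (\<lambda>x. \<Sum>i\<in>F. f i x)) g (finite_subsets_at_top I)"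
    using uniform_limit_const by blast
qed

lemma Cinf_summable_uniform_limit:
  assumes "Cinf_summable M f I" "compact K" "K \<subseteq> M"
  shows "uniform_limit K (\<lambda>F x. \<Sum>i\<in>F. f i x) (\<lambda>x. \<Sum>\<^sub>\<infinity>i\<in>I. f i x) (finite_subsets_at_top I)"
proof -
  \<comment> \<open>The empty list of derivatives stands for the partial sums themselves.\<close>
  obtain g where "uniform_limit K (\<lambda>F. partials [] (\<lambda>x. \<Sum>i\<in>F. f i x)) g (finite_subsets_at_top I)"
    using assms unfolding Cinf_summable_def by blast
  then have g: "uniform_limit K (\<lambda>F x. \<Sum>i\<in>F. f i x) g (finite_subsets_at_top I)"
    by (simp add: partials_def)
  have "(\<Sum>\<^sub>\<infinity>i\<in>I. f i x) = g x" if "x \<in> K" for x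
    using tendsto_uniform_limitI[OF g that] by (intro infsumI) (simp add: has_sum_def)
  then show ?thesis
    using g by (subst uniform_limit_cong'[of _ _ _ _ g]) auto
qed

lemma infsum_single:
  fixes f :: "'a \<Rightarrow> 'b :: {topological_comm_monoid_add, t2_space}"
  assumes "i0 \<in> I" "\<And>i. i \<in> I \<Longrightarrow> i \<noteq> i0 \<Longrightarrow> f i = 0"
  shows "infsum f I = f i0"
proof -
  have "infsum f I = infsum f {i0}"
    using assms by (intro infsum_cong_neutral) auto
  then show ?thesis by simp
qed

abbreviation (input) same_coeffs :: "field3 \<Rightarrow> field3 \<Rightarrow> bool" where
  "same_coeffs Z Z' \<equiv> \<forall>j\<in>{1, 2}. \<forall>(l, m)\<in>harm_index. L2_inner Z (Psi j l m) = L2_inner Z' (Psi j l m)"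

lemma multipole_same_coeffs:
  assumes "same_coeffs Z Z'" "i \<in> harm_index"
  shows "multipole f lam Z i = multipole f lam Z' i"
proof -
  obtain l m where i: "i = (l, m)" by (cases i)
  have "L2_inner Z (Psi 1 l m) = L2_inner Z' (Psi 1 l m)" "L2_inner Z (Psi 2 l m) = L2_inner Z' (Psi 2 l m)"
    using assms i by blast+
  then show ?thesis by (simp add: i multipole_def)
qed

lemma tilde_h_same_coeffs:
  assumes "same_coeffs Z Z'"
  shows "tilde_h lam Z = tilde_h lam Z'"
  unfolding tilde_h_def using multipole_same_coeffs[OF assms]
  by (intro ext infsum_cong) simp

lemma boundary_solution_same_coeffs:
  assumes "boundary_solution lam rho Y Z" "same_coeffs Z Z'" "Z' \<in> L2t"
  shows "boundary_solution lam rho Y Z'"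
  using assms tilde_h_same_coeffs[OF assms(2), of lam]
    Cinf_summable_cong[of harm_index "multipole sph_hankel lam Z" "multipole sph_hankel lam Z'" "exterior rho"]
    multipole_same_coeffs[OF assms(2)]
  unfolding boundary_solution_def by auto

(* The coefficients of Psi_1, Psi_2 (trace_coeff) and Psi_3 (radial_coeff) in the (l, m) term of
   tilde_j(Y) + tilde_h(Z) on the sphere of radius rho. *)
definition trace_coeff :: "real \<Rightarrow> real \<Rightarrow> field3 \<Rightarrow> field3 \<Rightarrow> nat \<Rightarrow> nat \<times> int \<Rightarrow> complex" where
  "trace_coeff lam rho Y Z j = (\<lambda>(l, m). let z = complex_of_real (lam * rho) in
     if j = 1 then (- \<i>) ^ l * complex_of_real lam *
       (2 * L2_inner Y (Psi 1 l m) * sph_bessel_j l z + L2_inner Z (Psi 1 l m) * sph_hankel l z)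
     else (- \<i>) ^ (l - 1) / complex_of_real rho *
       (2 * L2_inner Y (Psi 2 l m) * riccati sph_bessel_j l z + L2_inner Z (Psi 2 l m) * riccati sph_hankel l z))"

definition radial_coeff :: "real \<Rightarrow> real \<Rightarrow> field3 \<Rightarrow> field3 \<Rightarrow> nat \<times> int \<Rightarrow> complex" where
  "radial_coeff lam rho Y Z = (\<lambda>(l, m). let z = complex_of_real (lam * rho) in
     (- \<i>) ^ (l - 1) * complex_of_real (sqrt (real l * (real l + 1))) / complex_of_real rho *
       (2 * L2_inner Y (Psi 2 l m) * sph_bessel_j l z + L2_inner Z (Psi 2 l m) * sph_hankel l z))"

text \<open>By homogeneity of the vector harmonics the fields on the sphere of radius rho are read
  on the unit sphere, where orthonormality is available.\<close>

lemma multipole_on_sphere: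
  assumes "rho > 0" "norm x = 1"
  shows "2 *s multipole sph_bessel_j lam Y (l, m) (rho *\<^sub>R x) + multipole sph_hankel lam Z (l, m) (rho *\<^sub>R x)
    = trace_coeff lam rho Y Z 1 (l, m) *s Psi 1 l m x + trace_coeff lam rho Y Z 2 (l, m) *s Psi 2 l m x
      + radial_coeff lam rho Y Z (l, m) *s Psi 3 l m x"
proof -
  have "norm (rho *\<^sub>R x) = rho" "x \<noteq> 0" using assms by auto
  then show ?thesis
    using assms(1)
    by (simp add: multipole_def trace_coeff_def radial_coeff_def Psi_scale Let_def vec_eq_iff algebra_simps add_divide_distrib)
qed

text \<open>The prefactors are nonzero, and so are the two Hankel values at a real point; hence 2 a
  u + b v = 0 can be solved for b. This is the origin of the entries of A^t.\<close>

lemma trace_coeff_eq_0_iff: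
  assumes "rho > 0" "lam > 0" "j \<in> {1, 2}"
  shows "trace_coeff lam rho Y Z j (l, m) = 0
    \<longleftrightarrow> L2_inner Z (Psi j l m) = At_entry lam rho j l * L2_inner Y (Psi j l m)"
proof -
  have *: "2 * a * u + b * v = 0 \<longleftrightarrow> b = - (2 * u / v) * a" if "v \<noteq> 0" for a b u v :: complex
    using that by (auto simp: field_simps add_eq_0_iff)
  have "sph_hankel l (complex_of_real (lam * rho)) \<noteq> 0" "riccati sph_hankel l (complex_of_real (lam * rho)) \<noteq> 0"
    using assms by (auto intro!: sph_hankel_nonzero riccati_hankel_nonzero simp del: of_real_mult)
  then show ?thesis
    using assms * by (auto simp: trace_coeff_def At_entry_def Let_def simp del: of_real_mult)
qed

section \<open>Uniqueness: the tangential trace coefficients vanish\<close>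

lemma Psi_3: "norm x = 1 \<Longrightarrow> Psi 3 l m x = cvec (sph_harm l m x *\<^sub>R x)"
  by (simp add: Psi_def vsh_real_def)

lemma L2_inner_Psi_3:
  assumes "j \<in> {1, 2}"
  shows "L2_inner (Psi 3 l m) (Psi j l' m') = 0"
proof -
  have "(\<integral>x. (\<Sum>i\<in>UNIV. Psi 3 l m x $ i * cnj (Psi j l' m' x $ i)) \<partial>sphere_measure) = (\<integral>x. 0 \<partial>sphere_measure)"
  proof (rule Bochner_Integration.integral_cong[OF refl])
    fix x assume "x \<in> space sphere_measure"
    then have "norm x = 1" "x \<noteq> 0" by auto
    then show "(\<Sum>i\<in>UNIV. Psi 3 l m x $ i * cnj (Psi j l' m' x $ i)) = 0"
      using vsh_real_tangential[OF assms, of x l' m'] sum_cvec_cnj[of "sph_harm l m x *\<^sub>R x" "vsh_real j l' m' x"]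
      by (simp add: Psi_3 Psi_def[of j])
  qed
  then show ?thesis by (simp add: L2_inner_def)
qed

lemma L2_inner_trace_sum:
  assumes F: "finite F" "F \<subseteq> harm_index" and j: "j \<in> {1, 2}" and i: "(l, m) \<in> F"
  shows "L2_inner (\<lambda>x. \<Sum>i\<in>F. a i *s Psi 1 (fst i) (snd i) x + b i *s Psi 2 (fst i) (snd i) x + c i *s Psi 3 (fst i) (snd i) x) (Psi j l m)
    = (if j = 1 then a (l, m) else b (l, m))"
proof -
  let ?P = "\<lambda>j i. Psi j (fst i) (snd i)"
  let ?p = "\<lambda>j' i x. \<Sum>n\<in>UNIV. ?P j' i x $ n * cnj (Psi j l m x $ n)"
  have int: "integrable sphere_measure (?p j' i)" for j' i
    by (intro integrable_sphere_continuous continuous_intros continuous_on_Psi)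
  have "L2_inner (\<lambda>x. \<Sum>i\<in>F. a i *s ?P 1 i x + b i *s ?P 2 i x + c i *s ?P 3 i x) (Psi j l m)
    = (\<integral>x. (\<Sum>i\<in>F. a i * ?p 1 i x + b i * ?p 2 i x + c i * ?p 3 i x) \<partial>sphere_measure)"
  proof -
    have "(\<Sum>n\<in>UNIV. (\<Sum>i\<in>F. a i *s ?P 1 i x + b i *s ?P 2 i x + c i *s ?P 3 i x) $ n * cnj (Psi j l m x $ n))
      = (\<Sum>i\<in>F. a i * ?p 1 i x + b i * ?p 2 i x + c i * ?p 3 i x)" for x
      by (simp only: sum_component sum_distrib_right sum_distrib_left sum.distrib[symmetric])
        (subst sum.swap, simp add: algebra_simps)
    then show ?thesis by (simp only: L2_inner_def)
  qed
  also have "\<dots> = (\<Sum>i\<in>F. a i * L2_inner (?P 1 i) (Psi j l m) + b i * L2_inner (?P 2 i) (Psi j l m)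
      + c i * L2_inner (?P 3 i) (Psi j l m))"
    unfolding L2_inner_def using int
    by (subst Bochner_Integration.integral_sum)
      (auto intro!: Bochner_Integration.integrable_add integrable_mult_right sum.cong)
  also have "\<dots> = (\<Sum>i\<in>F. if i = (l, m) then (if j = 1 then a (l, m) else b (l, m)) else 0)"
  proof (rule sum.cong[OF refl])
    fix i assume "i \<in> F"
    then have "i \<in> harm_index" "(l, m) \<in> harm_index" using F i by auto
    then show "a i * L2_inner (?P 1 i) (Psi j l m) + b i * L2_inner (?P 2 i) (Psi j l m)
      + c i * L2_inner (?P 3 i) (Psi j l m) = (if i = (l, m) then (if j = 1 then a (l, m) else b (l, m)) else 0)"
      using j L2_inner_Psi[of 1 j "fst i" "snd i" l m] L2_inner_Psi[of 2 j "fst i" "snd i" l m] L2_inner_Psi_3[OF j, of "fst i" "snd i" l m]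
      by (cases i) auto
  qed
  also have "\<dots> = (if j = 1 then a (l, m) else b (l, m))"
    using F(1) i by simp
  finally show ?thesis .
qed

text \<open>The coefficient is the inner product of any large enough partial sum with Psi, while the
  limit V is pointwise orthogonal to Psi. Comparing the two under the integral bounds the
  coefficient by the uniform error, so V itself is never integrated and its measurability does not
  arise.\<close>

lemma boundary_solution_trace_coeff:
  assumes rho: "rho > 0" and bs: "boundary_solution lam rho Y Z"
    and j: "j \<in> {1, 2}" and lm: "(l, m) \<in> harm_index"
  shows "trace_coeff lam rho Y Z j (l, m) = 0"
proof -
  let ?K = "sphere 0 rho :: (real ^ 3) set" and ?FF = "finite_subsets_at_top harm_index"
  let ?T = "trace_coeff lam rho Y Z j (l, m)"
  define V where "V x = tilde_j lam Y x + tilde_h lam Z x" for x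
  define W where "W F x = (\<Sum>i\<in>F. 2 *s multipole sph_bessel_j lam Y i x + multipole sph_hankel lam Z i x)" for F x
  have K: "compact ?K" "?K \<subseteq> exterior rho"
    by (auto simp: exterior_def)
  \<comment> \<open>Writing the factor 2 as a sum lets \<open>uniform_limit_add\<close> handle
    it.\<close>
  have two: "2 *s v = v + v" for v :: "complex ^ 3"
    by (simp add: vec_eq_iff)
  have lim: "uniform_limit ?K W V ?FF"
  proof -
    have "uniform_limit ?K (\<lambda>F x. \<Sum>i\<in>F. multipole sph_bessel_j lam Y i x)
        (\<lambda>x. \<Sum>\<^sub>\<infinity>i\<in>harm_index. multipole sph_bessel_j lam Y i x) ?FF"
      "uniform_limit ?K (\<lambda>F x. \<Sum>i\<in>F. multipole sph_hankel lam Z i x)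
        (\<lambda>x. \<Sum>\<^sub>\<infinity>i\<in>harm_index. multipole sph_hankel lam Z i x) ?FF"
      using bs K by (auto simp: boundary_solution_def intro: Cinf_summable_uniform_limit)
    from uniform_limit_add[OF uniform_limit_add[OF this(1) this(1)] this(2)] show ?thesis
      by (simp add: V_def[abs_def] W_def[abs_def] tilde_j_def tilde_h_def two sum.distrib sum_distrib_left)
  qed
  obtain B where B: "B > 0" "\<And>x. norm x = 1 \<Longrightarrow> norm (Psi j l m x) \<le> B"
    using Psi_bounded by blast
  define \<mu> where "\<mu> = measure sphere_measure (sphere 0 1)"
  have "\<mu> \<ge> 0" by (simp add: \<mu>_def)
  have bound: "norm ?T \<le> e * (3 * B * \<mu>)" if "e > 0" for e
  proof -
    have "\<forall>\<^sub>F F in ?FF. finite F \<and> {(l, m)} \<subseteq> F \<and> F \<subseteq> harm_index"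
      using lm unfolding eventually_finite_subsets_at_top by (intro exI[of _ "{(l, m)}"]) auto
    moreover have "\<forall>\<^sub>F F in ?FF. \<forall>x\<in>?K. dist (W F x) (V x) < e"
      using lim that by (simp add: uniform_limit_iff)
    ultimately have "\<forall>\<^sub>F F in ?FF. norm ?T \<le> e * (3 * B * \<mu>)"
    proof eventually_elim
      case (elim F)
      define u where "u x = (\<Sum>i\<in>F. trace_coeff lam rho Y Z 1 i *s Psi 1 (fst i) (snd i) x
          + trace_coeff lam rho Y Z 2 i *s Psi 2 (fst i) (snd i) x + radial_coeff lam rho Y Z i *s Psi 3 (fst i) (snd i) x)" for x
      let ?q = "\<lambda>x. \<Sum>n\<in>UNIV. u x $ n * cnj (Psi j l m x $ n)"
      have u: "u x = W F (rho *\<^sub>R x)" if "norm x = 1" for x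
        unfolding W_def u_def using multipole_on_sphere[OF rho that, of lam Y _ _ Z]
        by (intro sum.cong) (auto simp: split_paired_all)
      have T: "?T = (\<integral>x. ?q x \<partial>sphere_measure)"
        using L2_inner_trace_sum[of F j l m] elim j by (auto simp: L2_inner_def u_def)
      have int: "integrable sphere_measure ?q"
        unfolding u_def
        by (intro integrable_sphere_continuous continuous_intros continuous_on_vector_smult continuous_on_Psi)
      have q: "norm (?q x) \<le> e * (3 * B)" if x: "norm x = 1" for x
      proof -
        have "rho *\<^sub>R x \<in> ?K" using x rho by simp
        then have "ccross ((rho *\<^sub>R x) /\<^sub>R rho) (V (rho *\<^sub>R x)) = 0"
          using bs unfolding boundary_solution_def V_def by blast
        then have "ccross x (V (rho *\<^sub>R x)) = 0"
          using rho by simp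
        moreover have d: "norm (W F (rho *\<^sub>R x) - V (rho *\<^sub>R x)) < e"
          using \<open>rho *\<^sub>R x \<in> ?K\<close> elim by (simp add: dist_norm)
        moreover have "x \<bullet> vsh_real j l m x = 0"
          using x by (intro vsh_real_tangential j) auto
        ultimately have "(\<Sum>n\<in>UNIV. V (rho *\<^sub>R x) $ n * cnj (Psi j l m x $ n)) = 0"
          unfolding Psi_def using x by (intro inner_eq_0_if_ccross_eq_0)
        then have "?q x = (\<Sum>n\<in>UNIV. (W F (rho *\<^sub>R x) - V (rho *\<^sub>R x)) $ n * cnj (Psi j l m x $ n))"
          using u[OF x] by (simp add: Rings.left_diff_distrib sum_subtractf)
        also have "norm \<dots> \<le> 3 * (norm (W F (rho *\<^sub>R x) - V (rho *\<^sub>R x)) * norm (Psi j l m x))"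
          by (rule norm_inner_cnj_le)
        also have "\<dots> \<le> 3 * (e * B)"
          using d B(2)[OF x] \<open>e > 0\<close> by (intro mult_left_mono mult_mono) auto
        finally show ?thesis by simp
      qed
      have "norm (\<integral>x. ?q x \<partial>sphere_measure) \<le> (\<integral>x. e * (3 * B) \<partial>sphere_measure)"
        using int q finite_measure.integrable_const[OF finite_measure_sphere]
        by (intro Bochner_Integration.integral_norm_bound_integral) auto
      then show ?case unfolding T by (simp add: \<mu>_def mult_ac)
    qed
    \<comment> \<open>The bound does not mention F, and the filter is nontrivial, so the eventual
      statement is the plain one.\<close>
    then show ?thesis
      by (simp add: eventually_const)
  qed
  have "norm ?T \<le> 0"
  proof (rule field_le_epsilon)
    fix e :: real assume "e > 0"
    define c where "c = 3 * B * \<mu>"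
    have c: "c \<ge> 0"
      using B(1) \<open>\<mu> \<ge> 0\<close> by (simp add: c_def)
    \<comment> \<open>The denominator is c + 1 because c = 0 is not excluded: only nonnegativity of
      \<open>\<mu>\<close> is at hand.\<close>
    have "norm ?T \<le> (e / (c + 1)) * c"
      unfolding c_def using \<open>e > 0\<close> c[unfolded c_def] by (intro bound divide_pos_pos) auto
    also have "\<dots> \<le> e"
      using \<open>e > 0\<close> c by (simp add: pos_divide_le_eq distrib_left)
    finally show "norm ?T \<le> 0 + e" by simp
  qed
  then show ?thesis by simp
qed

text \<open>Only one multipole is present, and its tangential part cancels, so the boundary value is
  normal. The hypotheses concern coefficients because \<open>At_op\<close> fixes its value no
  further than that.\<close>

lemma boundary_solution_single:
  assumes rho: "rho > 0" and lm: "(l, m) \<in> harm_index" and Z: "Z \<in> L2t"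
    and zero: "\<And>j l' m'. j \<in> {1, 2} \<Longrightarrow> (l', m') \<in> harm_index \<Longrightarrow> (l', m') \<noteq> (l, m)
      \<Longrightarrow> L2_inner Y (Psi j l' m') = 0 \<and> L2_inner Z (Psi j l' m') = 0"
    and tr: "\<And>j. j \<in> {1, 2} \<Longrightarrow> trace_coeff lam rho Y Z j (l, m) = 0"
  shows "boundary_solution lam rho Y Z"
proof -
  have 0: "multipole f lam Y i x = 0" "multipole f lam Z i x = 0"
    if "i \<in> harm_index" "i \<noteq> (l, m)" for f i x
  proof -
    obtain l' m' where i: "i = (l', m')" by (cases i)
    show "multipole f lam Y i x = 0" "multipole f lam Z i x = 0"
      using zero[of 1 l' m'] zero[of 2 l' m'] that unfolding i by (simp_all add: multipole_def)
  qed
  have "ccross (x /\<^sub>R rho) (tilde_j lam Y x + tilde_h lam Z x) = 0" if "x \<in> sphere 0 rho" for x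
  proof -
    define y where "y = x /\<^sub>R rho"
    have y: "norm y = 1" "x = rho *\<^sub>R y"
      using that rho by (auto simp: y_def)
    have "tilde_j lam Y x + tilde_h lam Z x = 2 *s multipole sph_bessel_j lam Y (l, m) x + multipole sph_hankel lam Z (l, m) x"
      unfolding tilde_j_def tilde_h_def using 0 lm by (simp add: infsum_single[of "(l, m)"])
    also have "\<dots> = radial_coeff lam rho Y Z (l, m) *s Psi 3 l m y"
      unfolding y(2) multipole_on_sphere[OF rho y(1)] using tr by simp
    finally show ?thesis
      using ccross_radial by (simp add: y_def[symmetric] Psi_3[OF y(1)])
  qed
  moreover have "Cinf_summable M (multipole f lam Y) harm_index" "Cinf_summable M (multipole f lam Z) harm_index" for M f
    by (intro Cinf_summable_single[OF lm] 0; assumption)+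
  ultimately show ?thesis
    using Z unfolding boundary_solution_def by blast
qed

lemma scattering_map_exists: "\<exists>A. is_scattering_map lam rho A" if "lam > 0" "rho > 0"
proof -
  define s :: "complex \<Rightarrow> field3 \<Rightarrow> field3" where "s c Y = (\<lambda>x. c *s Y x)" for c Y
  interpret vector_space s
    by unfold_locales (simp_all add: s_def fun_eq_iff vec_eq_iff algebra_simps)
  define N where "N = {Y \<in> L2t. AE x in sphere_measure. Y x = 0}"
  define R where "R Y Z \<longleftrightarrow> Y \<in> L2t \<and> Z \<in> L2t \<and> (\<forall>j\<in>{1, 2}. \<forall>(l, m)\<in>harm_index.
    L2_inner Z (Psi j l m) = At_entry lam rho j l * L2_inner Y (Psi j l m))" for Y Z
  have s_L2t: "s c Y \<in> L2t" if "Y \<in> L2t" for c Y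
    using L2t_smult[OF that] by (simp add: s_def)
  have add_L2t: "Y + Z \<in> L2t" if "Y \<in> L2t" "Z \<in> L2t" for Y Z
    using L2t_add[OF that] by (simp add: plus_fun_def)
  have zero: "(0 :: field3) \<in> L2t"
    using zero_in_L2t by (simp add: zero_fun_def)
  have ip_add: "L2_inner (Y + Z) (Psi j l m) = L2_inner Y (Psi j l m) + L2_inner Z (Psi j l m)"
    if "Y \<in> L2t" "Z \<in> L2t" for Y Z j l m
    using L2_inner_add[OF that] by (simp add: plus_fun_def)
  have ip_s: "L2_inner (s c Y) W = c * L2_inner Y W" for c Y W
    by (simp add: s_def L2_inner_smult)
  have "\<exists>A. Vector_Spaces.linear s s A \<and> (\<forall>n\<in>N. A n = 0) \<and> range A \<subseteq> L2t
    \<and> (\<forall>x. (\<exists>y. R x y) \<longrightarrow> R x (A x))"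
  proof (rule linear_selection)
    show "R n 0" if "n \<in> N" for n
      using that zero L2_inner_null[of n] L2_inner_null[of 0] by (auto simp: N_def R_def)
    show "subspace N"
      unfolding subspace_def N_def using zero add_L2t s_L2t
      by (auto simp: s_def elim!: AE_mp)
    show "R (x + x') (y + y')" if "R x y" "R x' y'" for x y x' y'
      using that add_L2t ip_add by (fastforce simp: R_def distrib_left)
    show "R (s c x) (s c y)" if "R x y" for c x y
      using that s_L2t ip_s by (fastforce simp: R_def)
    show "y \<in> L2t" if "R x y" for x y
      using that by (simp add: R_def)
    show "subspace L2t"
      unfolding subspace_def using zero add_L2t s_L2t by blast
  qed
  then obtain A where A: "Vector_Spaces.linear s s A" "\<And>n. n \<in> N \<Longrightarrow> A n = 0" "range A \<subseteq> L2t"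
    "\<And>x y. R x y \<Longrightarrow> R x (A x)"
    by metis
  interpret A: Vector_Spaces.linear s s A by (rule A(1))
  have "L2t_linear A"
    unfolding L2t_linear_def
  proof (intro conjI ballI allI impI)
    show "A Y \<in> L2t" for Y using A(3) by auto
    fix Y Y1 Y2 a b
    assume Y: "Y \<in> L2t" "Y1 \<in> L2t" "Y2 \<in> L2t" and ae: "AE x in sphere_measure. Y x = a *s Y1 x + b *s Y2 x"
    \<comment> \<open>The defect of the almost-everywhere relation is a null function, on which A
      vanishes; the relation between the images then even holds at every point.\<close>
    define n where "n = Y + s (-1) (s a Y1 + s b Y2)"
    have n: "n x = Y x - (a *s Y1 x + b *s Y2 x)" for x
      by (simp add: n_def s_def vec_eq_iff)
    have "n \<in> L2t"
      unfolding n_def by (intro add_L2t s_L2t Y)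
    moreover have "AE x in sphere_measure. n x = 0"
      using ae by eventually_elim (simp add: n)
    ultimately have "A n = 0"
      by (intro A(2)) (simp add: N_def)
    then have "(A Y + s (-1) (s a (A Y1) + s b (A Y2))) x $ i = 0" for x i
      unfolding n_def A.add A.scale by simp
    then have "A Y x $ i + (- (a * A Y1 x $ i) - b * A Y2 x $ i) = 0" for x i
      by (simp add: s_def)
    moreover have "p = q + r" if "p + (- q - r) = 0" for p q r :: complex
      using that by algebra
    ultimately have "A Y x $ i = a * A Y1 x $ i + b * A Y2 x $ i" for x i
      by blast
    then have "A Y x = a *s A Y1 x + b *s A Y2 x" for x
      by (simp add: vec_eq_iff)
    then show "AE x in sphere_measure. A Y x = a *s A Y1 x + b *s A Y2 x" by simp
  qed
  \<comment> \<open>The coefficients of any solution Z are forced, so \<open>A Y\<close> shares them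
    and inherits convergence and the boundary condition from Z.\<close>
  moreover have "boundary_solution lam rho Y (A Y)" if "Y \<in> L2t" "boundary_solution lam rho Y Z" for Y Z
  proof -
    have "R Y Z"
      unfolding R_def
      using that boundary_solution_trace_coeff[OF \<open>rho > 0\<close> that(2)] trace_coeff_eq_0_iff[OF \<open>rho > 0\<close> \<open>lam > 0\<close>]
      by (auto simp: boundary_solution_def)
    then have "R Y (A Y)" by (rule A(4))
    with \<open>R Y Z\<close> have "same_coeffs Z (A Y)" "A Y \<in> L2t"
      unfolding R_def by fastforce+
    then show ?thesis
      using boundary_solution_same_coeffs[OF that(2)] by blast
  qed
  ultimately show ?thesis
    unfolding is_scattering_map_def by blast
qed

text \<open>Besides the formula for \<open>E_curl\<close>, the conjuncts certify that no default
  value is involved: the denominators of \<open>At_entry\<close> are nonzero, and the choices behind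
  \<open>A_op\<close> and \<open>At_op\<close> are realised. Uniqueness is uniqueness of
  coefficients.\<close>

theorem lemma4:
  fixes lam rho :: real and j l :: nat and m :: int
  assumes "1 \<le> rho" and "0 < lam"
    and "j \<in> {1, 2}" and "1 \<le> l" and "\<bar>m\<bar> \<le> int l"
  shows "sph_hankel l (complex_of_real (lam * rho)) \<noteq> 0
    \<and> riccati sph_hankel l (complex_of_real (lam * rho)) \<noteq> 0
    \<and> Psi j l m \<in> L2t
    \<and> is_scattering_map lam rho (A_op lam rho)
    \<and> boundary_solution lam rho (Psi j l m) (A_op lam rho (Psi j l m))
    \<and> boundary_solution lam rho (Psi j l m) (At_op lam rho (Psi j l m))
    \<and> (\<forall>Z. boundary_solution lam rho (Psi j l m) Z \<longrightarrow>
         (\<forall>j'\<in>{1, 2}. \<forall>(l', m')\<in>harm_index.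
            L2_inner Z (Psi j' l' m') = L2_inner (At_op lam rho (Psi j l m)) (Psi j' l' m')))
    \<and> (\<forall>j'\<in>{1, 2}. \<forall>(l', m')\<in>harm_index.
         L2_inner (At_op lam rho (Psi j l m)) (Psi j' l' m') =
           (if (j', l', m') = (j, l, m) then At_entry lam rho j l else 0))
    \<and> (\<forall>x\<in>exterior rho.
         E_curl lam rho (Psi j l m) x
           = tilde_j lam (Psi j l m) x + tilde_h lam (At_op lam rho (Psi j l m)) x)"
proof -
  let ?Y = "Psi j l m" and ?Z = "At_op lam rho (Psi j l m)"
  have rho: "rho > 0" and lam: "lam > 0" and pos: "lam * rho \<noteq> 0"
    using assms by auto
  have lm: "(l, m) \<in> harm_index"
    using assms by (simp add: harm_index_def)
  have Y: "?Y \<in> L2t"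
    by (rule Psi_in_L2t[OF assms(3)])
  have ip: "L2_inner ?Y (Psi j' l' m') = (if (j', l', m') = (j, l, m) then 1 else 0)"
    if "j' \<in> {1, 2}" "(l', m') \<in> harm_index" for j' l' m'
    by (rule L2_inner_Psi[OF assms(3) that(1) lm that(2)])
  \<comment> \<open>A multiple of Psi itself witnesses that the choice in \<open>At_op\<close> is
    realised.\<close>
  have "(\<lambda>x. At_entry lam rho j l *s ?Y x) \<in> L2t \<and> (\<forall>j'\<in>{1, 2}. \<forall>(l', m')\<in>harm_index.
      L2_inner (\<lambda>x. At_entry lam rho j l *s ?Y x) (Psi j' l' m') = At_entry lam rho j' l' * L2_inner ?Y (Psi j' l' m'))"
    using L2t_smult[OF Y] ip by (auto simp: L2_inner_smult)
  from someI[where P = "\<lambda>Z. Z \<in> L2t \<and> (\<forall>j'\<in>{1, 2}. \<forall>(l', m')\<in>harm_index.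
      L2_inner Z (Psi j' l' m') = At_entry lam rho j' l' * L2_inner ?Y (Psi j' l' m'))", OF this]
  have Z: "?Z \<in> L2t" and Zip: "\<And>j' l' m'. j' \<in> {1, 2} \<Longrightarrow> (l', m') \<in> harm_index \<Longrightarrow>
      L2_inner ?Z (Psi j' l' m') = At_entry lam rho j' l' * L2_inner ?Y (Psi j' l' m')"
    unfolding At_op_def by blast+
  have diag: "L2_inner ?Z (Psi j' l' m') = (if (j', l', m') = (j, l, m) then At_entry lam rho j l else 0)"
    if "j' \<in> {1, 2}" "(l', m') \<in> harm_index" for j' l' m'
    using Zip[OF that] ip[OF that] by auto
  have bsZ: "boundary_solution lam rho ?Y ?Z"
  proof (rule boundary_solution_single[OF rho lm Z])
    show "trace_coeff lam rho ?Y ?Z j' (l, m) = 0" if "j' \<in> {1, 2}" for j'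
      using trace_coeff_eq_0_iff[OF rho lam that] Zip[OF that lm] by simp
    show "L2_inner ?Y (Psi j' l' m') = 0 \<and> L2_inner ?Z (Psi j' l' m') = 0"
      if "j' \<in> {1, 2}" "(l', m') \<in> harm_index" "(l', m') \<noteq> (l, m)" for j' l' m'
      using ip[OF that(1,2)] diag[OF that(1,2)] that(3) by auto
  qed
  have unique: "same_coeffs W ?Z" if "boundary_solution lam rho ?Y W" for W
    using boundary_solution_trace_coeff[OF rho that] trace_coeff_eq_0_iff[OF rho lam] Zip by auto
  have A: "is_scattering_map lam rho (A_op lam rho)"
    unfolding A_op_def by (rule someI_ex[OF scattering_map_exists[OF lam rho]])
  then have bsA: "boundary_solution lam rho ?Y (A_op lam rho ?Y)"
    using Y bsZ unfolding is_scattering_map_def by blast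
  have "E_curl lam rho ?Y x = tilde_j lam ?Y x + tilde_h lam ?Z x" for x
    unfolding E_curl_def tilde_h_same_coeffs[OF unique[OF bsA]] ..
  then show ?thesis
    using sph_hankel_nonzero[OF pos] riccati_hankel_nonzero[OF pos] Y A bsA bsZ unique diag
    by blast
qed

end
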